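(* Let $(P,\mathbf{L})$, $\mathbf{L}=(L_j)_{j=1}^d$, be a labelled polytope in an affine space $V$ of dimension $\ell$, and let $x_0$ be a point in the interior of $P$. For each $j$ let $F_j=\{x\in P: L_j(x)=0\}$ and let $P_j$ be the cone with basis $F_j$ and vertex $x_0$. Let $\mathrm{v}\in\mathcal{C}^1(P,\mathbb{R})$ be a positive function on $P$ and let $\mathrm{w}\in\mathcal{C}^0(P,\mathbb{R})$. Assume that the $(\mathrm{v},\mathrm{w})$-Donaldson–Futaki invariant $\mathcal{F}$ of $(P,\mathbf{L})$ vanishes on affine functions and that for all $j=1,\dots,d$ and all $x\in P_j$, $$\frac{1}{L_j(x_0)}\left(\mathrm{v}(x)(\ell+1)+d_x\mathrm{v}(x-x_0)\right)-\frac{\mathrm{w}(x)}{2}\geq 0.$$ Then $(P,\mathbf{L})$ is $(\mathrm{v},\mathrm{w})$-uniformly K-stable.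
   Context: $V$ is equipped with a fixed Lebesgue measure $dx$. A labelled polytope in $V$ is a pair $(P,\mathbf{L})$ where $P$ is a compact convex polytope (with non-empty interior) and $\mathbf{L}=(L_j)_{j=1}^d$ is a minimal set of affine functions with $P=\{x\in V: L_j(x)\geq 0\ \forall j\}$, $d$ being the number of facets of $P$. The cone $P_j$ is the convex hull of $F_j$ and $x_0$. The labelled boundary measure $d\sigma$ is the measure on $\partial P$ whose restriction to $F_j$ is defined by $dL_j\wedge d\sigma=-dx$. $\mathcal{C}^0(P,\mathbb{R})$ is the space of continuous functions on $P$; $\mathcal{C}^1(P,\mathbb{R})$ is the space of restrictions to $P$ of continuously differentiable functions defined on an open subset of $V$ containing $P$; $d_x\mathrm{v}$ is the differential of $\mathrm{v}$ at $x$, evaluated here on the vector $x-x_0$. The $(\mathrm{v},\mathrm{w})$-Donaldson–Futaki invariant is the functional $\mathcal{F}(f)=2\int_{\partial P}f\,\mathrm{v}\,d\sigma-\int_P f\,\mathrm{w}\,dx$ on continuous functions $f$ on $P$. Set $\|f\|_J=\inf_{l\in\mathrm{Aff}(V)}\int_P\left(f+l-\inf_P(f+l)\right)dx$, where $\mathrm{Aff}(V)$ is the space of affine functions on $V$. The labelled polytope $(P,\mathbf{L})$ is $(\mathrm{v},\mathrm{w})$-uniformly K-stable if there exists $\lambda>0$ such that $\mathcal{F}(f)\geq\lambda\|f\|_J$ for every continuous convex function $f$ on $P$. *)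

theory Defs
  imports "HOL-Analysis.Analysis"
begin

(* V is a Euclidean space 'a with dx = lborel; neither the inner product nor the origin
   enters a definition otherwise. *)

definition affine_fun :: "('a::real_vector \<Rightarrow> real) \<Rightarrow> bool" where
  "affine_fun f \<longleftrightarrow> linear (\<lambda>x. f x - f 0)"

definition facet :: "'a::euclidean_space set \<Rightarrow> (nat \<Rightarrow> 'a \<Rightarrow> real) \<Rightarrow> nat \<Rightarrow> 'a set" where
  "facet P L j = {x \<in> P. L j x = 0}"

definition labelled_polytope ::
  "'a::euclidean_space set \<Rightarrow> nat \<Rightarrow> (nat \<Rightarrow> 'a \<Rightarrow> real) \<Rightarrow> bool" where
  "labelled_polytope P d L \<longleftrightarrow>
     polytope P \<and> interior P \<noteq> {} \<and>
     card {F. F facet_of P} = d \<and>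
     (\<forall>j\<in>{1..d}. affine_fun (L j)) \<and>
     P = {x. \<forall>j\<in>{1..d}. L j x \<ge> 0} \<and>
     (\<forall>J. J \<subset> {1..d} \<longrightarrow> P \<noteq> {x. \<forall>j\<in>J. L j x \<ge> 0})"

definition facet_cone ::
  "'a::euclidean_space set \<Rightarrow> (nat \<Rightarrow> 'a \<Rightarrow> real) \<Rightarrow> 'a \<Rightarrow> nat \<Rightarrow> 'a set" where
  "facet_cone P L x\<^sub>0 j = convex hull (insert x\<^sub>0 (facet P L j))"

(* The measure sigma on the hyperplane {l = 0} determined by |dl /\ dsigma| = dx.  For a vector u
   with dl(u) = 1, sigma A is the volume of the prism {y + t u | y : A, 0 <= t <= 1}.  The result
   is independent of u, see wedge_hyperplane_measure below.  The minus sign in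
   dl /\ dsigma = -dx is the orientation of the boundary by the outward normal (l is
   nonnegative on the polytope); as a measure sigma is positive. *)
definition hyperplane_measure :: "('a::euclidean_space \<Rightarrow> real) \<Rightarrow> 'a measure" where
  "hyperplane_measure l =
     (let u = (SOME u. l u - l 0 = 1)
      in distr (density lborel (indicator {x. 0 \<le> l x \<and> l x \<le> 1})) borel
           (\<lambda>x. x - l x *\<^sub>R u))"

(* Facets overlap in null sets, see labelled_boundary_measure_facet below. *)
definition labelled_boundary_measure ::
  "'a::euclidean_space set \<Rightarrow> nat \<Rightarrow> (nat \<Rightarrow> 'a \<Rightarrow> real) \<Rightarrow> 'a measure" where
  "labelled_boundary_measure P d L =
     measure_of UNIV (sets borel)
       (\<lambda>A. \<Sum>j\<in>{1..d}. emeasure (hyperplane_measure (L j)) (A \<inter> facet P L j))"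

definition C1_on :: "'a::euclidean_space set \<Rightarrow> ('a \<Rightarrow> real) \<Rightarrow> bool" where
  "C1_on P v \<longleftrightarrow>
     (\<exists>U V (V' :: 'a \<Rightarrow> ('a \<Rightarrow>\<^sub>L real)).
        open U \<and> P \<subseteq> U \<and>
        (\<forall>x\<in>U. (V has_derivative blinfun_apply (V' x)) (at x)) \<and> continuous_on U V' \<and>
        (\<forall>x\<in>P. v x = V x))"

(* The differential at x of any C1 extension of v, see differential_on_eq below. *)
definition differential_on :: "'a::euclidean_space set \<Rightarrow> ('a \<Rightarrow> real) \<Rightarrow> 'a \<Rightarrow> 'a \<Rightarrow> real" where
  "differential_on P v x = frechet_derivative v (at x within P)"

definition donaldson_futaki ::
  "'a::euclidean_space set \<Rightarrow> nat \<Rightarrow> (nat \<Rightarrow> 'a \<Rightarrow> real) \<Rightarrow> ('a \<Rightarrow> real) \<Rightarrow> ('a \<Rightarrow> real) \<Rightarrow>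
   ('a \<Rightarrow> real) \<Rightarrow> real" where
  "donaldson_futaki P d L v w f =
     2 * (LINT x:frontier P|labelled_boundary_measure P d L. f x * v x)
     - (LINT x:P|lborel. f x * w x)"

definition J_norm :: "'a::euclidean_space set \<Rightarrow> ('a \<Rightarrow> real) \<Rightarrow> real" where
  "J_norm P f =
     (INF l\<in>{l. affine_fun l}. LINT x:P|lborel. (f x + l x - (INF y\<in>P. f y + l y)))"

definition uniformly_K_stable ::
  "'a::euclidean_space set \<Rightarrow> nat \<Rightarrow> (nat \<Rightarrow> 'a \<Rightarrow> real) \<Rightarrow> ('a \<Rightarrow> real) \<Rightarrow> ('a \<Rightarrow> real) \<Rightarrow> bool" where
  "uniformly_K_stable P d L v w \<longleftrightarrow>
     (\<exists>c>0. \<forall>f. continuous_on P f \<and> convex_on P f \<longrightarrow>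
        donaldson_futaki P d L v w f \<ge> c * J_norm P f)"


lemma affine_fun_add: "affine_fun l \<Longrightarrow> l (x + y) = l x + (l y - l 0)"
  unfolding affine_fun_def using linear_add[of "\<lambda>x. l x - l 0" x y] by simp

lemma affine_fun_scale: "affine_fun l \<Longrightarrow> l (c *\<^sub>R x) = c * (l x - l 0) + l 0"
  unfolding affine_fun_def using linear_scale[of "\<lambda>x. l x - l 0" c x] by simp

lemma affine_fun_add_scale: "affine_fun l \<Longrightarrow> l (x + c *\<^sub>R u) = l x + c * (l u - l 0)"
  by (simp add: affine_fun_add affine_fun_scale)

lemma affine_fun_measurable [measurable (raw)]:
  fixes l :: "'a::euclidean_space \<Rightarrow> real"
  assumes "affine_fun l" shows "l \<in> borel_measurable borel"
proof -
  have "continuous_on UNIV (\<lambda>x. l x - l 0)"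
    using assms unfolding affine_fun_def by (simp add: linear_continuous_on linear_conv_bounded_linear)
  then have "continuous_on UNIV (\<lambda>x. (l x - l 0) + l 0)"
    by (rule continuous_on_add) (rule continuous_on_const)
  then show ?thesis by (simp add: borel_measurable_continuous_onI)
qed

lemma sets_hyperplane_measure [simp, measurable_cong]: "sets (hyperplane_measure l) = sets borel"
  by (simp add: hyperplane_measure_def Let_def)

lemma nn_integral_translation:
  fixes f :: "'a::euclidean_space \<Rightarrow> ennreal"
  assumes [measurable]: "f \<in> borel_measurable borel"
  shows "(\<integral>\<^sup>+x. f (c + x) \<partial>lborel) = (\<integral>\<^sup>+x. f x \<partial>lborel)"
  by (subst lborel_distr_plus[of c, symmetric]) (simp add: nn_integral_distr)

lemma nn_integral_hyperplane_measure:
  fixes l :: "'a::euclidean_space \<Rightarrow> real"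
  assumes l: "affine_fun l" and [measurable]: "f \<in> borel_measurable borel"
  shows "(\<integral>\<^sup>+y. f y \<partial>hyperplane_measure l) =
    (\<integral>\<^sup>+x. indicator {0..1} (l x) * f (x - l x *\<^sub>R (SOME u. l u - l 0 = 1)) \<partial>lborel)"
proof -
  note [measurable] = affine_fun_measurable[OF l]
  show ?thesis
    unfolding hyperplane_measure_def Let_def
    apply (subst nn_integral_distr)
      apply measurable
    apply (subst nn_integral_density)
      apply measurable
    apply (intro nn_integral_cong)
    apply (auto simp: indicator_def)
    done
qed

text \<open>The relation \<open>dl \<and> d\<sigma> = dx\<close> in integrated form: Lebesgue measure disintegrates
  as \<open>dt \<otimes> d\<sigma>\<close> along every direction \<open>u\<close> with \<open>dl(u) = 1\<close>.\<close>

lemma wedge_hyperplane_measure: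
  fixes l :: "'a::euclidean_space \<Rightarrow> real"
  assumes l: "affine_fun l" and u: "l u - l 0 = 1" and f[measurable]: "f \<in> borel_measurable borel"
  shows "(\<integral>\<^sup>+t. (\<integral>\<^sup>+y. f (y + t *\<^sub>R u) \<partial>hyperplane_measure l) \<partial>lborel) = (\<integral>\<^sup>+x. f x \<partial>lborel)"
proof -
  define u' where "u' = (SOME u. l u - l 0 = 1)"
  have u': "l u' - l 0 = 1" unfolding u'_def by (rule someI[of _ u]) (rule u)
  note [measurable] = affine_fun_measurable[OF l]
  let ?I = "indicator {0..1} :: real \<Rightarrow> ennreal"
  have "(\<integral>\<^sup>+t. (\<integral>\<^sup>+y. f (y + t *\<^sub>R u) \<partial>hyperplane_measure l) \<partial>lborel)
      = (\<integral>\<^sup>+t. (\<integral>\<^sup>+x. ?I (l x) * f (x - l x *\<^sub>R u' + t *\<^sub>R u) \<partial>lborel) \<partial>lborel)"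
    unfolding u'_def by (intro nn_integral_cong) (subst nn_integral_hyperplane_measure[OF l]; simp)
  also have "\<dots> = (\<integral>\<^sup>+x. (\<integral>\<^sup>+t. ?I (l x) * f (x - l x *\<^sub>R u' + t *\<^sub>R u) \<partial>lborel) \<partial>lborel)"
    by (rule lborel_pair.Fubini') measurable
  also have "\<dots> = (\<integral>\<^sup>+x. (\<integral>\<^sup>+t. ?I (l x) * f (x - l x *\<^sub>R u' + (l x + t) *\<^sub>R u) \<partial>lborel) \<partial>lborel)"
    by (intro nn_integral_cong nn_integral_translation[symmetric]) measurable
  also have "\<dots> = (\<integral>\<^sup>+t. (\<integral>\<^sup>+x. ?I (l x) * f (x - l x *\<^sub>R u' + (l x + t) *\<^sub>R u) \<partial>lborel) \<partial>lborel)"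
    by (rule lborel_pair.Fubini'[symmetric]) measurable
  also have "\<dots> = (\<integral>\<^sup>+t. (\<integral>\<^sup>+x. ?I (l (- t *\<^sub>R u + x)) *
      f ((- t *\<^sub>R u + x) - l (- t *\<^sub>R u + x) *\<^sub>R u' + (l (- t *\<^sub>R u + x) + t) *\<^sub>R u) \<partial>lborel) \<partial>lborel)"
    by (intro nn_integral_cong nn_integral_translation[symmetric]) measurable
  also have "\<dots> = (\<integral>\<^sup>+t. (\<integral>\<^sup>+x. ?I (l x - t) * f (x + (l x - t) *\<^sub>R (u - u')) \<partial>lborel) \<partial>lborel)"
  proof -
    have "l (- t *\<^sub>R u + x) = l x - t" for t x
      using affine_fun_add_scale[OF l, of x "-t" u] u by (simp add: add.commute)
    moreover have "(- t *\<^sub>R u + x) - (l x - t) *\<^sub>R u' + ((l x - t) + t) *\<^sub>R u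
        = x + (l x - t) *\<^sub>R (u - u')" for t x
      by (simp add: algebra_simps)
    ultimately show ?thesis by presburger
  qed
  also have "\<dots> = (\<integral>\<^sup>+x. (\<integral>\<^sup>+t. ?I (l x - t) * f (x + (l x - t) *\<^sub>R (u - u')) \<partial>lborel) \<partial>lborel)"
    by (rule lborel_pair.Fubini') measurable
  also have "\<dots> = (\<integral>\<^sup>+x. (\<integral>\<^sup>+t. ?I t * f (x + t *\<^sub>R (u - u')) \<partial>lborel) \<partial>lborel)"
  proof (rule nn_integral_cong)
    fix x
    show "(\<integral>\<^sup>+t. ?I (l x - t) * f (x + (l x - t) *\<^sub>R (u - u')) \<partial>lborel)
        = (\<integral>\<^sup>+t. ?I t * f (x + t *\<^sub>R (u - u')) \<partial>lborel)"
      by (subst (2) nn_integral_real_affine[where c = "-1" and t = "l x"]) auto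
  qed
  also have "\<dots> = (\<integral>\<^sup>+t. (\<integral>\<^sup>+x. ?I t * f (x + t *\<^sub>R (u - u')) \<partial>lborel) \<partial>lborel)"
    by (rule lborel_pair.Fubini'[symmetric]) measurable
  also have "\<dots> = (\<integral>\<^sup>+t. ?I t * (\<integral>\<^sup>+x. f x \<partial>lborel) \<partial>lborel)"
  proof (rule nn_integral_cong)
    fix t
    have "(\<integral>\<^sup>+x. ?I t * f (x + t *\<^sub>R (u - u')) \<partial>lborel)
        = ?I t * (\<integral>\<^sup>+x. f (t *\<^sub>R (u - u') + x) \<partial>lborel)"
      by (subst nn_integral_cmult) (auto simp: add.commute)
    then show "(\<integral>\<^sup>+x. ?I t * f (x + t *\<^sub>R (u - u')) \<partial>lborel) = ?I t * (\<integral>\<^sup>+x. f x \<partial>lborel)"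
      by (simp add: nn_integral_translation)
  qed
  also have "\<dots> = (\<integral>\<^sup>+x. f x \<partial>lborel)"
    by (simp add: nn_integral_multc)
  finally show ?thesis .
qed

lemma labelled_polytope_closed: "labelled_polytope P d L \<Longrightarrow> closed P"
  unfolding labelled_polytope_def by (blast intro: polytope_imp_closed)

lemma facet_borel:
  assumes "labelled_polytope P d L" "j \<in> {1..d}"
  shows "facet P L j \<in> sets borel"
proof -
  have [measurable]: "L j \<in> borel_measurable borel"
    using assms by (simp add: labelled_polytope_def affine_fun_measurable)
  have [measurable]: "P \<in> sets borel" using labelled_polytope_closed[OF assms(1)] by simp
  have "{x \<in> space borel. x \<in> P \<and> L j x = 0} \<in> sets borel" by measurable
  then show ?thesis by (simp add: facet_def)
qed

lemma sets_labelled_boundary_measure [simp, measurable_cong]: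
  "sets (labelled_boundary_measure P d L) = sets borel"
  unfolding labelled_boundary_measure_def
  using sets.sets_measure_of_eq[of borel] by simp

lemma emeasure_labelled_boundary_measure:
  assumes P: "labelled_polytope P d L" and A: "A \<in> sets borel"
  shows "emeasure (labelled_boundary_measure P d L) A =
    (\<Sum>j\<in>{1..d}. emeasure (hyperplane_measure (L j)) (A \<inter> facet P L j))"
proof (rule emeasure_measure_of[OF labelled_boundary_measure_def])
  show "sets borel \<subseteq> Pow UNIV" by simp
  show "A \<in> sets (labelled_boundary_measure P d L)" using A by simp
  show "positive (sets (labelled_boundary_measure P d L))
     (\<lambda>A. \<Sum>j\<in>{1..d}. emeasure (hyperplane_measure (L j)) (A \<inter> facet P L j))"
    by (simp add: positive_def)
  show "countably_additive (sets (labelled_boundary_measure P d L))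
     (\<lambda>A. \<Sum>j\<in>{1..d}. emeasure (hyperplane_measure (L j)) (A \<inter> facet P L j))"
  proof (rule countably_additiveI)
    fix B :: "nat \<Rightarrow> 'a set"
    assume B: "range B \<subseteq> sets (labelled_boundary_measure P d L)" "disjoint_family B"
    have "(\<Sum>i. \<Sum>j\<in>{1..d}. emeasure (hyperplane_measure (L j)) (B i \<inter> facet P L j))
        = (\<Sum>j\<in>{1..d}. \<Sum>i. emeasure (hyperplane_measure (L j)) (B i \<inter> facet P L j))"
      by (rule suminf_sum) auto
    also have "\<dots> = (\<Sum>j\<in>{1..d}. emeasure (hyperplane_measure (L j)) ((\<Union>i. B i) \<inter> facet P L j))"
    proof (rule sum.cong[OF refl])
      fix j assume j: "j \<in> {1..d}"
      have "(\<Sum>i. emeasure (hyperplane_measure (L j)) (B i \<inter> facet P L j))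
          = emeasure (hyperplane_measure (L j)) (\<Union>i. B i \<inter> facet P L j)"
        using B facet_borel[OF P j]
        by (intro suminf_emeasure) (auto simp: disjoint_family_on_def)
      then show "(\<Sum>i. emeasure (hyperplane_measure (L j)) (B i \<inter> facet P L j))
          = emeasure (hyperplane_measure (L j)) ((\<Union>i. B i) \<inter> facet P L j)"
        by (simp add: Int_UN_distrib2)
    qed
    finally show "(\<Sum>i. \<Sum>j\<in>{1..d}. emeasure (hyperplane_measure (L j)) (B i \<inter> facet P L j))
      = (\<Sum>j\<in>{1..d}. emeasure (hyperplane_measure (L j)) ((\<Union>i. B i) \<inter> facet P L j))" .
  qed
qed

lemma affine_fun_inner:
  fixes l :: "'a::euclidean_space \<Rightarrow> real"
  assumes "affine_fun l"
  obtains a where "\<And>x. l x = a \<bullet> x + l 0"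
proof -
  have "linear (\<lambda>x. l x - l 0)" using assms by (simp add: affine_fun_def)
  then have "l x - l 0 = (adjoint (\<lambda>x. l x - l 0) 1) \<bullet> x" for x
    using adjoint_works[of "\<lambda>x. l x - l 0" x "1::real"] by (simp add: inner_commute)
  then show ?thesis using that by (metis diff_add_cancel)
qed

lemma labelled_polytope_minimal:
  assumes P: "labelled_polytope P d L" and k: "k \<in> {1..d}"
  obtains x where "\<And>j. j \<in> {1..d} - {k} \<Longrightarrow> L j x \<ge> 0" "L k x < 0"
proof -
  let ?Q = "{x. \<forall>j\<in>{1..d} - {k}. L j x \<ge> 0}"
  have Peq: "P = {x. \<forall>j\<in>{1..d}. L j x \<ge> 0}"
    and minim: "\<forall>J. J \<subset> {1..d} \<longrightarrow> P \<noteq> {x. \<forall>j\<in>J. L j x \<ge> 0}"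
    by (rule P[unfolded labelled_polytope_def, THEN conjunct2, THEN conjunct2, THEN conjunct2,
          THEN conjunct2, THEN conjunct1]
        P[unfolded labelled_polytope_def, THEN conjunct2, THEN conjunct2, THEN conjunct2,
          THEN conjunct2, THEN conjunct2])+
  have "{1..d} - {k} \<subset> {1..d}" using k by blast
  then have "P \<noteq> ?Q" by (rule minim[rule_format])
  moreover have "P \<subseteq> ?Q" by (subst Peq) auto
  ultimately obtain x where x: "x \<in> ?Q" "x \<notin> P" by auto
  have "L k x < 0"
  proof (rule ccontr)
    assume "\<not> L k x < 0"
    then have "\<forall>j\<in>{1..d}. L j x \<ge> 0" using x(1) by fastforce
    then show False using x(2) by (subst (asm) Peq) blast
  qed
  then show ?thesis using that x(1) by blast
qed

lemma facet_overlap_null: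
  assumes P: "labelled_polytope P d L" and j: "j \<in> {1..d}" and k: "k \<in> {1..d}" and "j \<noteq> k"
    and A: "A \<in> sets borel" "A \<subseteq> facet P L j \<inter> facet P L k"
  shows "emeasure (hyperplane_measure (L j)) A = 0"
proof -
  have lj: "affine_fun (L j)" and lk: "affine_fun (L k)"
    and Peq: "P = {x. \<forall>i\<in>{1..d}. L i x \<ge> 0}" and int: "interior P \<noteq> {}"
    using P j k by (auto simp: labelled_polytope_def)
  obtain a where a: "\<And>x. L j x = a \<bullet> x + L j 0" using affine_fun_inner[OF lj] by blast
  obtain b where b: "\<And>x. L k x = b \<bullet> x + L k 0" using affine_fun_inner[OF lk] by blast
  obtain p where p: "p \<in> interior P" using int by auto
  obtain xj where xj: "\<And>i. i \<in> {1..d} - {j} \<Longrightarrow> L i xj \<ge> 0" "L j xj < 0"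
    using labelled_polytope_minimal[OF P j] by blast
  obtain xk where xk: "\<And>i. i \<in> {1..d} - {k} \<Longrightarrow> L i xk \<ge> 0" "L k xk < 0"
    using labelled_polytope_minimal[OF P k] by blast
  have pP: "p \<in> P" using p interior_subset by blast
  have "L j p \<ge> 0" "L k p \<ge> 0" using pP Peq j k by auto
  define u where "u = (SOME u. L j u - L j 0 = 1)"
  have "a \<noteq> 0" using xj(2) \<open>L j p \<ge> 0\<close> a by (metis inner_zero_left leD)
  then have "L j ((1 / (a \<bullet> a)) *\<^sub>R a) - L j 0 = 1" by (subst a) simp
  then have u: "L j u - L j 0 = 1" unfolding u_def by (rule someI)
  then have au: "a \<bullet> u = 1" using a[of u] by simp
  define c where "c = b - (b \<bullet> u) *\<^sub>R a"
  define e where "e = (b \<bullet> u) * L j 0 - L k 0"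
  have eq: "L k (x - L j x *\<^sub>R u) = c \<bullet> x - e" for x
    unfolding c_def e_def by (subst b, subst a) (simp add: algebra_simps)
  have ce: "c \<noteq> 0 \<or> e \<noteq> 0"
  proof (rule ccontr)
    assume "\<not> (c \<noteq> 0 \<or> e \<noteq> 0)"
    then have "b = (b \<bullet> u) *\<^sub>R a" "L k 0 = (b \<bullet> u) * L j 0" by (auto simp: c_def e_def)
    then have pr: "L k x = (b \<bullet> u) * L j x" for x
      by (metis a b distrib_left inner_scaleR_left)
    have "L j xk \<ge> 0" using xk(1) j \<open>j \<noteq> k\<close> by auto
    then have neg: "b \<bullet> u < 0" using xk(2) pr by (metis linorder_not_le mult_nonneg_nonneg)
    have "L j x = 0" if "x \<in> P" for x
    proof -
      have "L j x \<ge> 0" "L k x \<ge> 0" using that Peq j k by auto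
      then show ?thesis using pr[of x] neg by (simp add: zero_le_mult_iff)
    qed
    then have "P \<subseteq> {x. a \<bullet> x = - L j 0}" using a by (smt (verit) mem_Collect_eq subsetI)
    then have "interior P \<subseteq> interior {x. a \<bullet> x = - L j 0}" by (rule interior_mono)
    then show False using int \<open>a \<noteq> 0\<close> by simp
  qed
  note [measurable] = affine_fun_measurable[OF lj] A(1)
  have "emeasure (hyperplane_measure (L j)) A = (\<integral>\<^sup>+y. indicator A y \<partial>hyperplane_measure (L j))"
    by simp
  also have "\<dots> = (\<integral>\<^sup>+x. indicator {0..1} (L j x) * indicator A (x - L j x *\<^sub>R u) \<partial>lborel)"
    unfolding u_def by (rule nn_integral_hyperplane_measure[OF lj]) measurable
  also have "\<dots> \<le> (\<integral>\<^sup>+x. indicator {x. c \<bullet> x = e} x \<partial>lborel)"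
  proof (rule nn_integral_mono)
    fix x
    have "L k (x - L j x *\<^sub>R u) = 0" if "x - L j x *\<^sub>R u \<in> A"
      using that A(2) by (auto simp: facet_def)
    then show "indicator {0..1} (L j x) * indicator A (x - L j x *\<^sub>R u)
        \<le> (indicator {x. c \<bullet> x = e} x :: ennreal)"
      using eq[of x] by (auto simp: indicator_def)
  qed
  also have "\<dots> = emeasure lborel {x. c \<bullet> x = e}"
    by (subst nn_integral_indicator) (auto simp: closed_hyperplane)
  also have "\<dots> = 0"
    using negligible_hyperplane[OF ce] 
    by (simp add: negligible_iff_null_sets null_sets_completion_iff closed_hyperplane null_setsD1)
  finally show ?thesis by simp
qed

lemma labelled_boundary_measure_facet:
  assumes P: "labelled_polytope P d L" and j: "j \<in> {1..d}"
    and A: "A \<in> sets borel" "A \<subseteq> facet P L j"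
  shows "emeasure (labelled_boundary_measure P d L) A = emeasure (hyperplane_measure (L j)) A"
proof -
  have "emeasure (hyperplane_measure (L k)) (A \<inter> facet P L k) = 0" if k: "k \<in> {1..d}" "k \<noteq> j" for k
    using A facet_borel[OF P k(1)] by (intro facet_overlap_null[OF P k(1) j k(2)]) auto
  then have "(\<Sum>k\<in>{1..d} - {j}. emeasure (hyperplane_measure (L k)) (A \<inter> facet P L k)) = 0"
    by (intro sum.neutral) auto
  then show ?thesis
    unfolding emeasure_labelled_boundary_measure[OF P A(1)] sum.remove[OF finite_atLeastAtMost j]
    using A(2) by (simp add: Int_absorb2)
qed

lemma has_derivative_convex_unique:
  fixes v :: "'a::euclidean_space \<Rightarrow> real"
  assumes P: "convex P" "interior P \<noteq> {}" "x \<in> P"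
    and D: "(v has_derivative D) (at x within P)" and E: "(v has_derivative E) (at x within P)"
  shows "D = E"
proof -
  have lin: "linear (\<lambda>h. D h - E h)"
    using D E by (intro linear_compose_sub) (auto dest: has_derivative_linear)
  have *: "D (y - x) = E (y - x)" if "y \<in> P" for y
  proof -
    define g where "g t = x + t *\<^sub>R (y - x)" for t :: real
    have img: "g ` {0..1} \<subseteq> P"
    proof clarify
      fix t :: real assume "t \<in> {0..1}"
      then have "(1 - t) *\<^sub>R x + t *\<^sub>R y \<in> P" using P that by (auto simp: convex_alt)
      then show "g t \<in> P" by (simp add: g_def algebra_simps)
    qed
    have g: "(g has_derivative (\<lambda>t. t *\<^sub>R (y - x))) (at 0 within {0..1})"
      unfolding g_def by (auto intro!: derivative_eq_intros)
    have chain: "((v \<circ> g) has_derivative F \<circ> (\<lambda>t. t *\<^sub>R (y - x))) (at 0 within {0..1})"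
      if "(v has_derivative F) (at x within P)" for F
    proof (rule diff_chain_within[OF g])
      show "(v has_derivative F) (at (g 0) within g ` {0..1})"
        using has_derivative_subset[OF that img] by (simp add: g_def)
    qed
    have "D \<circ> (\<lambda>t. t *\<^sub>R (y - x)) = E \<circ> (\<lambda>t. t *\<^sub>R (y - x))"
      by (rule frechet_derivative_unique_within_closed_interval[of "0::real" 1 0, unfolded box_real])
         (use chain[OF D] chain[OF E] in auto)
    then have "(D \<circ> (\<lambda>t. t *\<^sub>R (y - x))) 1 = (E \<circ> (\<lambda>t. t *\<^sub>R (y - x))) 1" by simp
    then show ?thesis by simp
  qed
  obtain p r where r: "r > 0" "ball p r \<subseteq> P" using P(2) by (meson ex_in_conv mem_interior)
  have "D h - E h = 0" for h
  proof -
    define c where "c = r / (2 * (norm h + 1))"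
    have c: "c > 0" unfolding c_def using r by (simp add: add_nonneg_pos)
    have "norm (c *\<^sub>R h) < r"
    proof -
      have "norm (c *\<^sub>R h) = r * (norm h / (2 * (norm h + 1)))" using c r by (simp add: c_def)
      also have "\<dots> < r * 1"
      proof (rule mult_strict_left_mono[OF _ r(1)])
        have "0 < 2 * (norm h + 1)" "norm h < 2 * (norm h + 1)"
          using norm_ge_zero[of h] by argo+
        then show "norm h / (2 * (norm h + 1)) < 1" by (simp only: divide_less_eq_1_pos)
      qed
      finally show ?thesis by simp
    qed
    then have "p + c *\<^sub>R h \<in> P" "p \<in> P" using r by (auto simp: dist_norm)
    then have "D (p + c *\<^sub>R h - x) - E (p + c *\<^sub>R h - x) = 0" "D (p - x) - E (p - x) = 0"
      using * by auto
    moreover have "p + c *\<^sub>R h - x = (p - x) + c *\<^sub>R h" by simp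
    ultimately have "c * (D h - E h) = 0"
      using linear_add[OF lin, of "p - x" "c *\<^sub>R h"] linear_scale[OF lin, of c h] by simp
    then show ?thesis using c by simp
  qed
  then show ?thesis by (auto simp: fun_eq_iff)
qed

lemma differential_on_eq:
  fixes v V :: "'a::euclidean_space \<Rightarrow> real"
  assumes "convex P" "interior P \<noteq> {}" "x \<in> P"
    and "(V has_derivative D) (at x)" "\<And>y. y \<in> P \<Longrightarrow> v y = V y"
  shows "differential_on P v x = D"
proof -
  have "(V has_derivative D) (at x within P)" using assms(4) by (rule has_derivative_at_withinI)
  then have D: "(v has_derivative D) (at x within P)"
    by (rule has_derivative_transform[OF \<open>x \<in> P\<close>, rotated]) (use assms in auto)
  then have "(v has_derivative frechet_derivative v (at x within P)) (at x within P)"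
    using frechet_derivative_works differentiable_def by blast
  then show ?thesis
    unfolding differential_on_def using has_derivative_convex_unique assms(1-3) D by blast
qed

end

theory Submission
  imports Defs
begin

text \<open>Why the theorem holds. Write \<open>n\<close> for the dimension, \<open>\<F>\<close> for the Donaldson-Futaki invariant
  and \<open>C\<^sub>j\<close> for the cone over the facet \<open>F\<^sub>j\<close> with vertex \<open>x\<^sub>0\<close>. On \<open>C\<^sub>j\<close> use the coordinates
  \<open>x = x\<^sub>0 + t (y - x\<^sub>0)\<close> with \<open>y \<in> F\<^sub>j\<close> and \<open>t \<in> [0, 1]\<close>, in which
  \<open>dx = L\<^sub>j(x\<^sub>0) t\<^bsup>n-1\<^esup> dt d\<sigma>(y)\<close> (\<open>cone_integral\<close>). The function
  \<open>E(x) = (n + 1) v(x) + d\<^sub>xv(x - x\<^sub>0)\<close> satisfies \<open>t\<^sup>n E = d/dt (t\<^bsup>n+1\<^esup> v)\<close> along every ray, and the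
  hypothesis says that the defect \<open>D\<^sub>j = E / L\<^sub>j(x\<^sub>0) - w / 2\<close> is nonnegative on \<open>C\<^sub>j\<close>.

  Let \<open>f\<close> be convex and continuous. Subtracting a supporting affine function at \<open>x\<^sub>0\<close> changes neither
  \<open>\<F>(f)\<close> nor the \<open>J\<close>-norm, and gives a convex \<open>g \<ge> 0\<close> with \<open>g(x\<^sub>0) = 0\<close>. Its \<open>J\<close>-norm is at most
  \<open>\<integral>\<^sub>P g\<close>, so a bound \<open>\<F>(g) \<ge> \<lambda> \<integral>\<^sub>P g\<close> suffices. By convexity \<open>\<rho>(t) = g(x\<^sub>0 + t (y - x\<^sub>0)) / t\<close> is
  nondecreasing, and an integration by parts, in the form of the second mean value theorem, gives
  (\<open>futaki_lower_bound\<close>), with \<open>m = min v > 0\<close>,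
  \<open>\<F>(g) / 2 \<ge> \<Sum>\<^sub>j \<integral> D\<^sub>j g dx + m \<Sum>\<^sub>j \<integral> G(y) d\<sigma>(y)\<close>, the integrals being over \<open>C\<^sub>j\<close> and \<open>F\<^sub>j\<close>.
  The convexity gap \<open>G(y) = g(y) - (n + 1) \<integral> t\<^bsup>n-1\<^esup> g dt\<close>, over the ray of \<open>y\<close>, is nonnegative and
  measures how far \<open>g\<close> is from being linear on that ray: it bounds \<open>\<rho>(1) - \<rho>(\<epsilon>)\<close> from above, up to a
  power of \<open>\<epsilon>\<close>. Hence \<open>g\<close>, and so \<open>\<integral>\<^sub>P g\<close>, is controlled by the gap together with the values of
  \<open>g\<close> in a small ball around \<open>x\<^sub>0\<close> (\<open>integral_le_defect_plus_gap\<close>).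

  It remains to bound those values by the defect term. For affine \<open>l\<close> the integration by parts is
  an identity, and \<open>\<F>(l) = 0\<close> becomes \<open>\<Sum>\<^sub>j \<integral> D\<^sub>j l dx = M l(x\<^sub>0)\<close> with a constant \<open>M > 0\<close>
  (\<open>defect_integral_affine\<close>, \<open>vertex_mass_pos\<close>). Thus the measure with density \<open>D\<^sub>j\<close> on \<open>C\<^sub>j\<close> is
  nonzero and has barycentre \<open>x\<^sub>0\<close>, so \<open>x\<^sub>0\<close> lies in the convex hull of the open set where the density is
  positive (\<open>x\<^sub>0_in_hull_defect_support\<close>). Finitely many points of that set span a neighbourhood of
  \<open>x\<^sub>0\<close>; a nonnegative convex function with small defect integral is small at these points, by the
  mean value inequality on balls, and therefore on their convex hull.\<close>

section \<open>Integrals along a ray\<close>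

text \<open>At \<open>s = 0\<close> the quotient is \<open>0\<close> by the convention on division by zero. Since \<open>\<phi>\<close> is nonnegative,
  monotonicity extends to the closed interval, as the second mean value theorem requires.\<close>

lemma convex_quotient_mono:
  fixes \<phi> :: "real \<Rightarrow> real"
  assumes "convex_on {0..1} \<phi>" "\<phi> 0 = 0" "\<And>t. t \<in> {0..1} \<Longrightarrow> 0 \<le> \<phi> t"
    and "0 \<le> s" "s \<le> t" "t \<le> 1"
  shows "\<phi> s / s \<le> \<phi> t / t"
proof (cases "s = 0")
  case True
  then show ?thesis using assms by simp
next
  case False
  with assms have "0 < s" "0 < t" by auto
  have "\<phi> ((1 - s / t) *\<^sub>R 0 + (s / t) *\<^sub>R t) \<le> (1 - s / t) * \<phi> 0 + (s / t) * \<phi> t"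
    using \<open>0 < s\<close> \<open>0 < t\<close> assms(4-6) by (intro convex_onD[OF assms(1)]) auto
  then show ?thesis using \<open>0 < s\<close> \<open>0 < t\<close> assms(2) by (simp add: field_simps)
qed

text \<open>For smooth \<open>\<phi>\<close> this would follow from integrating \<open>t\<^bsup>n-1\<^esup> (V - m) (t \<phi>' - \<phi>) \<ge> 0\<close> by parts. No
  derivative of \<open>\<phi>\<close> is needed: with \<open>\<rho> = \<phi> / t\<close> nondecreasing and \<open>H = t\<^bsup>n+1\<^esup> (V - m) \<ge> 0\<close> the claim is
  \<open>\<integral> \<rho> H' \<le> \<rho>(1) H(1)\<close>, and the second mean value theorem evaluates the left-hand side as
  \<open>\<rho>(1) (H(1) - H(c))\<close> for some \<open>c\<close>.\<close>

lemma radial_integral_le: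
  fixes \<phi> V V' :: "real \<Rightarrow> real" and n :: nat
  assumes n: "n > 0"
    and \<phi>: "convex_on {0..1} \<phi>" "continuous_on {0..1} \<phi>" "\<phi> 0 = 0" "\<And>t. t \<in> {0..1} \<Longrightarrow> 0 \<le> \<phi> t"
    and V: "\<And>t. t \<in> {0..1} \<Longrightarrow> (V has_real_derivative V' t) (at t within {0..1})"
    and V': "continuous_on {0..1} V'"
    and m: "\<And>t. t \<in> {0..1} \<Longrightarrow> m \<le> V t"
  shows "integral {0..1} (\<lambda>t. t ^ (n - 1) * (\<phi> t * ((n + 1) * V t + t * V' t)))
      + m * (\<phi> 1 - (n + 1) * integral {0..1} (\<lambda>t. t ^ (n - 1) * \<phi> t)) \<le> \<phi> 1 * V 1"
proof -
  define H where "H t = t ^ (n + 1) * (V t - m)" for t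
  define H' where "H' t = t ^ n * ((n + 1) * (V t - m) + t * V' t)" for t
  have contV: "continuous_on {0..1} V" using V by (meson DERIV_continuous continuous_on_eq_continuous_within)
  have H: "(H has_real_derivative H' t) (at t within {0..1})" if "t \<in> {0..1}" for t
    unfolding H_def H'_def
    by (rule derivative_eq_intros V[OF that] refl)+ (simp add: algebra_simps)
  have FTC: "(H' has_integral H 1 - H c) {c..1}" if "c \<in> {0..1}" for c
    using that
    by (intro fundamental_theorem_of_calculus)
       (auto simp flip: has_real_derivative_iff_has_vector_derivative intro: DERIV_subset[OF H])
  have "H' integrable_on {0..1}" using FTC[of 0] by (auto simp: integrable_on_def)
  then obtain c where c: "c \<in> {0..1}"
    "integral {0..1} (\<lambda>t. \<phi> t / t * H' t)
      = \<phi> 0 / 0 * integral {0..c} H' + \<phi> 1 / 1 * integral {c..1} H'"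
    by (rule second_mean_value_theorem[where g = "\<lambda>t. \<phi> t / t"])
       (use convex_quotient_mono \<phi> in auto)
  have "integral {c..1} H' \<le> H 1"
    using FTC[OF c(1)] c(1) m[OF c(1)] by (auto simp: H_def dest!: integral_unique)
  then have *: "integral {0..1} (\<lambda>t. \<phi> t / t * H' t) \<le> \<phi> 1 * (V 1 - m)"
    using c(2) \<phi>(4)[of 1] by (simp add: H_def mult_left_mono)
  have i1: "(\<lambda>t. t ^ (n - 1) * (\<phi> t * ((n + 1) * V t + t * V' t))) integrable_on {0..1}"
    and i2: "(\<lambda>t. t ^ (n - 1) * \<phi> t) integrable_on {0..1}"
    by (intro integrable_continuous_real continuous_intros \<phi> contV V')+
  have eq: "\<phi> t / t * H' t = t ^ (n - 1) * (\<phi> t * ((n + 1) * V t + t * V' t))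
      - m * (n + 1) * (t ^ (n - 1) * \<phi> t)" for t
  proof (cases "t = 0")
    case False
    then have "t ^ n = t ^ (n - 1) * t" using n by (metis power_minus_mult)
    then show ?thesis using False by (simp add: H'_def field_simps)
  qed (use \<phi> in auto)
  have "integral {0..1} (\<lambda>t. \<phi> t / t * H' t)
      = integral {0..1} (\<lambda>t. t ^ (n - 1) * (\<phi> t * ((n + 1) * V t + t * V' t)))
      - integral {0..1} (\<lambda>t. m * (n + 1) * (t ^ (n - 1) * \<phi> t))"
    unfolding eq by (intro integral_diff i1 integrable_on_mult_right i2)
  also have "integral {0..1} (\<lambda>t. m * (n + 1) * (t ^ (n - 1) * \<phi> t))
      = m * (n + 1) * integral {0..1} (\<lambda>t. t ^ (n - 1) * \<phi> t)"
    by (rule integral_mult_right)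
  finally show ?thesis using * by (simp only: right_diff_distrib mult.assoc mult.commute[of m])
qed

text \<open>The right-hand side vanishes when \<open>\<phi>\<close> is linear. Quantitatively, \<open>\<phi>(t) / t\<close> is at most \<open>\<phi>(\<epsilon>) / \<epsilon>\<close>
  before \<open>\<epsilon>\<close> and at most \<open>\<phi>(1)\<close> after it; integrating these two bounds against \<open>t\<^sup>n\<close> gives the estimate.\<close>

lemma radial_convexity_gap:
  fixes \<phi> :: "real \<Rightarrow> real" and n :: nat
  assumes n: "n > 0"
    and \<phi>: "convex_on {0..1} \<phi>" "continuous_on {0..1} \<phi>" "\<phi> 0 = 0" "\<And>t. t \<in> {0..1} \<Longrightarrow> 0 \<le> \<phi> t"
    and \<epsilon>: "0 < \<epsilon>" "\<epsilon> \<le> 1"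
  shows "\<epsilon> ^ (n + 1) * (\<phi> 1 - \<phi> \<epsilon> / \<epsilon>)
    \<le> \<phi> 1 - (n + 1) * integral {0..1} (\<lambda>t. t ^ (n - 1) * \<phi> t)"
proof -
  have pow: "((\<lambda>t. c * t ^ n) has_integral c * (b ^ (n + 1) - a ^ (n + 1)) / (n + 1)) {a..b}"
    if "a \<le> b" for a b c :: real
  proof -
    have D: "((\<lambda>t. c / (n + 1) * t ^ (n + 1)) has_real_derivative c * t ^ n) (at t within {a..b})" for t
      by (rule derivative_eq_intros refl)+ simp
    have "((\<lambda>t. c * t ^ n) has_integral c / (n + 1) * b ^ (n + 1) - c / (n + 1) * a ^ (n + 1)) {a..b}"
      using that D by (intro fundamental_theorem_of_calculus)
         (auto simp flip: has_real_derivative_iff_has_vector_derivative)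
    then show ?thesis by (simp add: right_diff_distrib diff_divide_distrib)
  qed
  have le: "t ^ (n - 1) * \<phi> t \<le> (\<phi> s / s) * t ^ n" if "0 \<le> t" "t \<le> s" "s \<le> 1" for s t
  proof (cases "t = 0")
    case False
    have "t ^ n = t ^ (n - 1) * t" using n by (metis power_minus_mult)
    moreover have "t ^ n * (\<phi> t / t) \<le> t ^ n * (\<phi> s / s)"
      using that convex_quotient_mono[OF \<phi>(1,3,4)] by (intro mult_left_mono) auto
    ultimately show ?thesis using False by (simp add: mult.commute)
  qed (use \<phi> n in \<open>auto simp: power_0_left\<close>)
  have int: "(\<lambda>t. t ^ (n - 1) * \<phi> t) integrable_on {0..1}"
    by (intro integrable_continuous_real continuous_intros \<phi>)
  have "integral {0..1} (\<lambda>t. t ^ (n - 1) * \<phi> t)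
      = integral {0..\<epsilon>} (\<lambda>t. t ^ (n - 1) * \<phi> t) + integral {\<epsilon>..1} (\<lambda>t. t ^ (n - 1) * \<phi> t)"
    using \<epsilon> int by (intro Henstock_Kurzweil_Integration.integral_combine[symmetric]) auto
  also have "integral {0..\<epsilon>} (\<lambda>t. t ^ (n - 1) * \<phi> t) \<le> (\<phi> \<epsilon> / \<epsilon>) * (\<epsilon> ^ (n + 1) - 0 ^ (n + 1)) / (n + 1)"
    by (rule has_integral_le[OF integrable_integral[OF integrable_subinterval_real[OF int]] pow])
       (use \<epsilon> le in auto)
  also have "integral {\<epsilon>..1} (\<lambda>t. t ^ (n - 1) * \<phi> t) \<le> (\<phi> 1 / 1) * (1 ^ (n + 1) - \<epsilon> ^ (n + 1)) / (n + 1)"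
    by (rule has_integral_le[OF integrable_integral[OF integrable_subinterval_real[OF int]] pow])
       (use \<epsilon> le[of _ 1] in auto)
  finally have "integral {0..1} (\<lambda>t. t ^ (n - 1) * \<phi> t)
      \<le> ((\<phi> \<epsilon> / \<epsilon>) * \<epsilon> ^ (n + 1) + \<phi> 1 * (1 - \<epsilon> ^ (n + 1))) / (n + 1)"
    by (simp add: add_divide_distrib)
  then have "integral {0..1} (\<lambda>t. t ^ (n - 1) * \<phi> t) * (n + 1)
      \<le> (\<phi> \<epsilon> / \<epsilon>) * \<epsilon> ^ (n + 1) + \<phi> 1 * (1 - \<epsilon> ^ (n + 1))"
    by (subst (asm) pos_le_divide_eq) auto
  then show ?thesis
    by (simp only: right_diff_distrib mult.commute[of "_ / \<epsilon>"] mult.commute[of "\<phi> 1"]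
        mult.commute[of "real (n + 1)"])
qed

text \<open>The integrand differs from \<open>q t\<^bsup>n-1\<^esup> V\<close> by the derivative of \<open>t\<^sup>n (p t + q) V\<close>.\<close>

lemma radial_integral_affine:
  fixes V V' :: "real \<Rightarrow> real" and n :: nat
  assumes n: "n > 0"
    and V: "\<And>t. t \<in> {0..1} \<Longrightarrow> (V has_real_derivative V' t) (at t within {0..1})"
    and V': "continuous_on {0..1} V'"
  shows "integral {0..1} (\<lambda>t. t ^ (n - 1) * ((p * t + q) * ((n + 1) * V t + t * V' t)))
      = (p + q) * V 1 + q * integral {0..1} (\<lambda>t. t ^ (n - 1) * V t)"
proof -
  define H where "H t = t ^ n * (p * t + q) * V t" for t
  define H' where "H' t = t ^ (n - 1) * ((p * t + q) * ((n + 1) * V t + t * V' t))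
     - q * (t ^ (n - 1) * V t)" for t
  have contV: "continuous_on {0..1} V" using V by (meson DERIV_continuous continuous_on_eq_continuous_within)
  have pn: "t ^ n = t ^ (n - 1) * t" for t :: real using n by (metis power_minus_mult)
  have H: "(H has_real_derivative H' t) (at t within {0..1})" if "t \<in> {0..1}" for t
    unfolding H_def H'_def
    by (rule derivative_eq_intros V[OF that] refl)+ (simp add: pn algebra_simps)
  have "(H' has_integral H 1 - H 0) {0..1}"
    by (intro fundamental_theorem_of_calculus)
       (auto simp flip: has_real_derivative_iff_has_vector_derivative intro: H)
  then have "integral {0..1} H' = (p + q) * V 1" using n by (auto simp: H_def dest!: integral_unique)
  moreover have "integral {0..1} H' = integral {0..1} (\<lambda>t. t ^ (n - 1) * ((p * t + q) * ((n + 1) * V t + t * V' t)))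
      - integral {0..1} (\<lambda>t. q * (t ^ (n - 1) * V t))"
    unfolding H'_def by (intro integral_diff integrable_continuous_real continuous_intros contV V')
  ultimately show ?thesis by simp
qed

section \<open>Cone coordinates\<close>

lemma nn_integral_lborel_homothety:
  fixes f :: "'a::euclidean_space \<Rightarrow> ennreal"
  assumes [measurable]: "f \<in> borel_measurable borel" and "c \<noteq> 0"
  shows "(\<integral>\<^sup>+x. f x \<partial>lborel) = ennreal (\<bar>c\<bar> ^ DIM('a)) * (\<integral>\<^sup>+x. f (b + c *\<^sub>R x) \<partial>lborel)"
  by (subst lborel_affine[OF \<open>c \<noteq> 0\<close>, of b])
     (simp add: nn_integral_density nn_integral_distr nn_integral_cmult)

lemma AE_hyperplane_measure:
  fixes l :: "'a::euclidean_space \<Rightarrow> real"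
  assumes l: "affine_fun l" and u: "l u - l 0 = 1"
  shows "AE y in hyperplane_measure l. l y = 0"
proof -
  define u' where "u' = (SOME u. l u - l 0 = 1)"
  have u': "l u' - l 0 = 1" unfolding u'_def by (rule someI[of _ u]) (rule u)
  note [measurable] = affine_fun_measurable[OF l]
  have "l (x - l x *\<^sub>R u') = 0" for x
    using affine_fun_add_scale[OF l, of x "- l x" u'] u' by simp
  then have "AE x in density lborel (indicator {x. 0 \<le> l x \<and> l x \<le> 1}). l (x - l x *\<^sub>R u') = 0"
    by simp
  then show ?thesis
    unfolding hyperplane_measure_def Let_def u'_def by (subst AE_distr_iff) simp_all
qed

text \<open>The volume of a prism is its height times the area of its base, for every direction \<open>u\<close>
  transversal to the hyperplane and every height \<open>c\<close>.\<close>

lemma nn_integral_prism: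
  fixes l :: "'a::euclidean_space \<Rightarrow> real"
  assumes l: "affine_fun l" and u: "l u - l 0 = 1" and [measurable]: "f \<in> borel_measurable borel"
    and "0 \<le> c"
  shows "(\<integral>\<^sup>+x. indicator {0..c} (l x) * f (x - l x *\<^sub>R u) \<partial>lborel)
    = ennreal c * (\<integral>\<^sup>+y. f y \<partial>hyperplane_measure l)"
proof -
  note [measurable] = affine_fun_measurable[OF l]
  have "(\<integral>\<^sup>+x. indicator {0..c} (l x) * f (x - l x *\<^sub>R u) \<partial>lborel)
     = (\<integral>\<^sup>+t. (\<integral>\<^sup>+y. indicator {0..c} (l (y + t *\<^sub>R u)) * f (y + t *\<^sub>R u - l (y + t *\<^sub>R u) *\<^sub>R u)
          \<partial>hyperplane_measure l) \<partial>lborel)"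
    by (rule wedge_hyperplane_measure[OF l u, symmetric]) measurable
  also have "\<dots> = (\<integral>\<^sup>+t. (\<integral>\<^sup>+y. indicator {0..c} t * f y \<partial>hyperplane_measure l) \<partial>lborel)"
  proof (rule nn_integral_cong, rule nn_integral_cong_AE)
    fix t
    show "AE y in hyperplane_measure l.
        indicator {0..c} (l (y + t *\<^sub>R u)) * f (y + t *\<^sub>R u - l (y + t *\<^sub>R u) *\<^sub>R u)
        = indicator {0..c} t * f y"
      using AE_hyperplane_measure[OF l u]
    proof eventually_elim
      case (elim y)
      have "l (y + t *\<^sub>R u) = t" using affine_fun_add_scale[OF l, of y t u] u elim by simp
      then show ?case by simp
    qed
  qed
  also have "\<dots> = (\<integral>\<^sup>+t. (\<integral>\<^sup>+y. f y \<partial>hyperplane_measure l) * indicator {0..c} t \<partial>lborel)"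
    by (intro nn_integral_cong) (subst nn_integral_cmult, auto simp: mult.commute)
  also have "\<dots> = ennreal c * (\<integral>\<^sup>+y. f y \<partial>hyperplane_measure l)"
    using \<open>0 \<le> c\<close> by (simp add: nn_integral_cmult_indicator mult.commute)
  finally show ?thesis .
qed

text \<open>A homothety of ratio \<open>t\<close> centred on the hyperplane scales the volume of prisms by \<open>t\<^sup>n\<close> and
  their heights by \<open>t\<close>, hence the area of their bases by \<open>t\<^bsup>n-1\<^esup>\<close>.\<close>

lemma nn_integral_hyperplane_homothety:
  fixes l :: "'a::euclidean_space \<Rightarrow> real"
  assumes l: "affine_fun l" and u: "l u - l 0 = 1" and [measurable]: "f \<in> borel_measurable borel"
    and y\<^sub>0: "l y\<^sub>0 = 0" and t: "0 < t"
  shows "(\<integral>\<^sup>+y. f y \<partial>hyperplane_measure l)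
    = ennreal (t ^ (DIM('a) - 1)) * (\<integral>\<^sup>+y. f (y\<^sub>0 + t *\<^sub>R (y - y\<^sub>0)) \<partial>hyperplane_measure l)"
proof -
  note [measurable] = affine_fun_measurable[OF l]
  let ?b = "(1 - t) *\<^sub>R y\<^sub>0"
  let ?g = "\<lambda>y. f (y\<^sub>0 + t *\<^sub>R (y - y\<^sub>0))"
  have lb: "l (?b + t *\<^sub>R x) = t * l x" for x
    using y\<^sub>0 affine_fun_add_scale[OF l, of ?b t x] affine_fun_scale[OF l, of "1 - t" y\<^sub>0]
    by (simp add: algebra_simps)
  have "ennreal t * (\<integral>\<^sup>+y. f y \<partial>hyperplane_measure l)
      = (\<integral>\<^sup>+x. indicator {0..t} (l x) * f (x - l x *\<^sub>R u) \<partial>lborel)"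
    using t by (intro nn_integral_prism[OF l u, symmetric]) auto
  also have "\<dots> = ennreal (\<bar>t\<bar> ^ DIM('a)) *
      (\<integral>\<^sup>+x. indicator {0..t} (l (?b + t *\<^sub>R x)) * f (?b + t *\<^sub>R x - l (?b + t *\<^sub>R x) *\<^sub>R u) \<partial>lborel)"
    using t by (intro nn_integral_lborel_homothety) auto
  also have "(\<integral>\<^sup>+x. indicator {0..t} (l (?b + t *\<^sub>R x)) * f (?b + t *\<^sub>R x - l (?b + t *\<^sub>R x) *\<^sub>R u) \<partial>lborel)
      = (\<integral>\<^sup>+x. indicator {0..1} (l x) * ?g (x - l x *\<^sub>R u) \<partial>lborel)"
  proof (intro nn_integral_cong)
    fix x
    have "?b + t *\<^sub>R x - l (?b + t *\<^sub>R x) *\<^sub>R u = y\<^sub>0 + t *\<^sub>R (x - l x *\<^sub>R u - y\<^sub>0)"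
      unfolding lb by (simp add: algebra_simps)
    moreover have "indicator {0..t} (l (?b + t *\<^sub>R x)) = (indicator {0..1} (l x) :: ennreal)"
      unfolding lb using t by (auto simp: indicator_def zero_le_mult_iff)
    ultimately show "indicator {0..t} (l (?b + t *\<^sub>R x)) * f (?b + t *\<^sub>R x - l (?b + t *\<^sub>R x) *\<^sub>R u)
        = indicator {0..1} (l x) * ?g (x - l x *\<^sub>R u)" by presburger
  qed
  also have "\<dots> = ennreal 1 * (\<integral>\<^sup>+y. ?g y \<partial>hyperplane_measure l)"
    by (rule nn_integral_prism[OF l u]) auto
  finally have *: "ennreal t * (\<integral>\<^sup>+y. f y \<partial>hyperplane_measure l)
      = ennreal (t ^ DIM('a)) * (\<integral>\<^sup>+y. ?g y \<partial>hyperplane_measure l)"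
    using t by simp
  have "ennreal (t ^ DIM('a)) = ennreal t * ennreal (t ^ (DIM('a) - 1))"
    using t by (simp flip: ennreal_mult' add: power_eq_if)
  with * have "ennreal t * (\<integral>\<^sup>+y. f y \<partial>hyperplane_measure l)
      = ennreal t * (ennreal (t ^ (DIM('a) - 1)) * (\<integral>\<^sup>+y. ?g y \<partial>hyperplane_measure l))"
    by (simp add: mult.assoc)
  then show ?thesis
    using t by (subst (asm) ennreal_mult_cancel_left) auto
qed

text \<open>Slice the slab by the hyperplanes \<open>l = s\<close>. The slice \<open>s = (1 - t) l(x\<^sub>0)\<close> is the image of \<open>l = 0\<close>
  under the homothety of ratio \<open>t\<close> with centre \<open>x\<^sub>0\<close>, which is a homothety of ratio \<open>t\<close> inside \<open>l = 0\<close>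
  followed by a translation.\<close>

lemma nn_integral_cone_coordinates:
  fixes l :: "'a::euclidean_space \<Rightarrow> real"
  assumes l: "affine_fun l" and u: "l u - l 0 = 1" and f[measurable]: "f \<in> borel_measurable borel"
    and a: "0 < l x\<^sub>0"
  shows "(\<integral>\<^sup>+x. indicator {0..<l x\<^sub>0} (l x) * f x \<partial>lborel)
    = (\<integral>\<^sup>+t. indicator {0<..1} t * (ennreal (l x\<^sub>0 * t ^ (DIM('a) - 1)) *
        (\<integral>\<^sup>+y. f (x\<^sub>0 + t *\<^sub>R (y - x\<^sub>0)) \<partial>hyperplane_measure l)) \<partial>lborel)"
proof -
  note [measurable] = affine_fun_measurable[OF l]
  let ?a = "l x\<^sub>0" and ?\<sigma> = "hyperplane_measure l"
  \<comment> \<open>The projection of \<open>x\<^sub>0\<close> to the hyperplane along \<open>u\<close> serves as centre of the homothety.\<close>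
  define y\<^sub>0 where "y\<^sub>0 = x\<^sub>0 - ?a *\<^sub>R u"
  have y\<^sub>0: "l y\<^sub>0 = 0" using affine_fun_add_scale[OF l, of x\<^sub>0 "- ?a" u] u by (simp add: y\<^sub>0_def)
  define G where "G s = indicator {0..<?a} s * (\<integral>\<^sup>+y. f (y + s *\<^sub>R u) \<partial>?\<sigma>)" for s
  have [measurable]: "G \<in> borel_measurable borel"
  proof -
    have "G = (\<lambda>s. indicator {0..<?a} s *
        (\<integral>\<^sup>+x. indicator {0..1} (l x) * f (x - l x *\<^sub>R (SOME u. l u - l 0 = 1) + s *\<^sub>R u) \<partial>lborel))"
      unfolding G_def by (intro ext) (subst nn_integral_hyperplane_measure[OF l]; simp)
    then show ?thesis by simp
  qed
  have "(\<integral>\<^sup>+x. indicator {0..<?a} (l x) * f x \<partial>lborel)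
     = (\<integral>\<^sup>+s. (\<integral>\<^sup>+y. indicator {0..<?a} (l (y + s *\<^sub>R u)) * f (y + s *\<^sub>R u) \<partial>?\<sigma>) \<partial>lborel)"
    by (rule wedge_hyperplane_measure[OF l u, symmetric]) measurable
  also have "\<dots> = (\<integral>\<^sup>+s. (\<integral>\<^sup>+y. indicator {0..<?a} s * f (y + s *\<^sub>R u) \<partial>?\<sigma>) \<partial>lborel)"
  proof (rule nn_integral_cong, rule nn_integral_cong_AE)
    fix s
    show "AE y in ?\<sigma>. indicator {0..<?a} (l (y + s *\<^sub>R u)) * f (y + s *\<^sub>R u)
        = indicator {0..<?a} s * f (y + s *\<^sub>R u)"
      using AE_hyperplane_measure[OF l u]
    proof eventually_elim
      case (elim y)
      have "l (y + s *\<^sub>R u) = s" using affine_fun_add_scale[OF l, of y s u] u elim by simp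
      then show ?case by simp
    qed
  qed
  also have "\<dots> = (\<integral>\<^sup>+s. G s \<partial>lborel)"
    unfolding G_def by (intro nn_integral_cong) (simp add: nn_integral_cmult)
  also have "\<dots> = \<bar>- ?a\<bar> * (\<integral>\<^sup>+t. G (?a + (- ?a) * t) \<partial>lborel)"
    using a by (intro nn_integral_real_affine) auto
  also have "\<dots> = (\<integral>\<^sup>+t. ennreal ?a * G (?a + (- ?a) * t) \<partial>lborel)"
    using a by (simp add: nn_integral_cmult)
  also have "\<dots> = (\<integral>\<^sup>+t. indicator {0<..1} t * (ennreal (?a * t ^ (DIM('a) - 1)) *
        (\<integral>\<^sup>+y. f (x\<^sub>0 + t *\<^sub>R (y - x\<^sub>0)) \<partial>?\<sigma>)) \<partial>lborel)"
  proof (intro nn_integral_cong)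
    fix t :: real
    have ind: "indicator {0..<?a} (?a + (- ?a) * t) = (indicator {0<..1} t :: ennreal)"
      using a by (auto simp: indicator_def zero_less_mult_iff)
    show "ennreal ?a * G (?a + (- ?a) * t) = indicator {0<..1} t * (ennreal (?a * t ^ (DIM('a) - 1)) *
        (\<integral>\<^sup>+y. f (x\<^sub>0 + t *\<^sub>R (y - x\<^sub>0)) \<partial>?\<sigma>))"
    proof (cases "t \<in> {0<..1}")
      case True
      have "(\<integral>\<^sup>+y. f (y + (?a + (- ?a) * t) *\<^sub>R u) \<partial>?\<sigma>) = ennreal (t ^ (DIM('a) - 1)) *
          (\<integral>\<^sup>+y. f (y\<^sub>0 + t *\<^sub>R (y - y\<^sub>0) + (?a + (- ?a) * t) *\<^sub>R u) \<partial>?\<sigma>)"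
        using True by (intro nn_integral_hyperplane_homothety[OF l u _ y\<^sub>0]) auto
      also have "(\<lambda>y. y\<^sub>0 + t *\<^sub>R (y - y\<^sub>0) + (?a + (- ?a) * t) *\<^sub>R u) = (\<lambda>y. x\<^sub>0 + t *\<^sub>R (y - x\<^sub>0))"
        by (simp add: y\<^sub>0_def algebra_simps)
      finally show ?thesis
        unfolding G_def ind using True a by (simp add: ennreal_mult mult.assoc)
    qed (simp only: G_def ind, simp)
  qed
  finally show ?thesis .
qed

lemma emeasure_hyperplane_measure_bounded:
  fixes l :: "'a::euclidean_space \<Rightarrow> real"
  assumes l: "affine_fun l" and F: "F \<in> sets borel" "bounded F"
  shows "emeasure (hyperplane_measure l) F < \<infinity>"
proof -
  note [measurable] = affine_fun_measurable[OF l] F(1)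
  define u where "u = (SOME u. l u - l 0 = 1)"
  obtain B where B: "\<And>x. x \<in> F \<Longrightarrow> norm x \<le> B" using F(2) by (auto simp: bounded_iff)
  have "emeasure (hyperplane_measure l) F = (\<integral>\<^sup>+y. indicator F y \<partial>hyperplane_measure l)" by simp
  also have "\<dots> = (\<integral>\<^sup>+x. indicator {0..1} (l x) * indicator F (x - l x *\<^sub>R u) \<partial>lborel)"
    unfolding u_def by (rule nn_integral_hyperplane_measure[OF l]) measurable
  also have "\<dots> \<le> (\<integral>\<^sup>+x. indicator (cball (0::'a) (B + norm u)) x \<partial>lborel)"
  proof (rule nn_integral_mono)
    fix x
    have "norm x \<le> B + norm u" if "0 \<le> l x" "l x \<le> 1" "x - l x *\<^sub>R u \<in> F"
    proof -
      have "norm x \<le> norm (x - l x *\<^sub>R u) + norm (l x *\<^sub>R u)"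
        using norm_triangle_ineq[of "x - l x *\<^sub>R u" "l x *\<^sub>R u"] by simp
      also have "\<dots> \<le> B + 1 * norm u"
        using that B by (intro add_mono) (auto intro: mult_left_le_one_le)
      finally show ?thesis by simp
    qed
    then show "indicator {0..1} (l x) * indicator F (x - l x *\<^sub>R u)
        \<le> (indicator (cball (0::'a) (B + norm u)) x :: ennreal)"
      by (auto simp: indicator_def)
  qed
  also have "\<dots> < \<infinity>" using emeasure_bounded_finite[OF bounded_cball] by simp
  finally show ?thesis .
qed

text \<open>A cone is the image of the product of its base and the interval \<open>[0, 1]\<close>, with the following two
  measures on the factors. Both are finite, so that Fubini's theorem is available.\<close>

definition cone_base_measure :: "('a::euclidean_space \<Rightarrow> real) \<Rightarrow> 'a set \<Rightarrow> 'a measure" where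
  "cone_base_measure l F = density (hyperplane_measure l) (indicator F)"

definition cone_radius_measure :: "nat \<Rightarrow> real \<Rightarrow> real measure" where
  "cone_radius_measure n a = density lborel (\<lambda>t. ennreal (indicator {0..1} t * (a * t ^ (n - 1))))"

lemma sets_cone_base_measure [simp, measurable_cong]: "sets (cone_base_measure l F) = sets borel"
  by (simp add: cone_base_measure_def)

lemma space_cone_base_measure [simp]: "space (cone_base_measure l F) = UNIV"
  using sets_eq_imp_space_eq[OF sets_cone_base_measure] by simp

lemma sets_cone_radius_measure [simp, measurable_cong]: "sets (cone_radius_measure n a) = sets borel"
  by (simp add: cone_radius_measure_def)

lemma finite_cone_base_measure:
  assumes "affine_fun l" "F \<in> sets borel" "bounded F"
  shows "finite_measure (cone_base_measure l F)"
  using emeasure_hyperplane_measure_bounded[OF assms] assms(2)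
  by (intro finite_measureI)
     (auto simp: cone_base_measure_def emeasure_density sets_eq_imp_space_eq[OF sets_hyperplane_measure])

lemma finite_cone_radius_measure:
  assumes "0 \<le> a"
  shows "finite_measure (cone_radius_measure n a)"
proof (intro finite_measureI)
  have "emeasure (cone_radius_measure n a) (space (cone_radius_measure n a))
      = (\<integral>\<^sup>+t. ennreal (indicator {0..1} t * (a * t ^ (n - 1))) \<partial>lborel)"
    by (simp add: cone_radius_measure_def emeasure_density)
  also have "\<dots> \<le> (\<integral>\<^sup>+t. ennreal a * indicator {0..1} (t::real) \<partial>lborel)"
    using assms
    by (intro nn_integral_mono) (auto simp: indicator_def intro!: ennreal_leI mult_left_le power_le_one)
  also have "\<dots> < \<infinity>" using assms by (simp add: nn_integral_cmult_indicator)
  finally show "emeasure (cone_radius_measure n a) (space (cone_radius_measure n a)) \<noteq> \<infinity>" by simp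
qed

text \<open>Lebesgue measure on a cone \<open>C\<close> over \<open>F\<close>, as an equality of measures: this transfers integrals of
  functions of arbitrary sign from the formula for nonnegative functions.\<close>

lemma density_cone_eq_distr:
  fixes l :: "'a::euclidean_space \<Rightarrow> real"
  assumes l: "affine_fun l" and u: "l u - l 0 = 1" and a: "0 < l x\<^sub>0"
    and F: "F \<in> sets borel" "bounded F" and C: "C \<in> sets borel"
    and C_ge: "\<And>x. x \<in> C \<Longrightarrow> 0 \<le> l x" and C_less: "\<And>x. x \<in> C \<Longrightarrow> x \<noteq> x\<^sub>0 \<Longrightarrow> l x < l x\<^sub>0"
    and CF: "\<And>y t. l y = 0 \<Longrightarrow> 0 < t \<Longrightarrow> t \<le> 1 \<Longrightarrow> x\<^sub>0 + t *\<^sub>R (y - x\<^sub>0) \<in> C \<longleftrightarrow> y \<in> F"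
  shows "density lborel (indicator C) =
    distr (cone_base_measure l F \<Otimes>\<^sub>M cone_radius_measure DIM('a) (l x\<^sub>0)) borel
      (\<lambda>(y, t). x\<^sub>0 + t *\<^sub>R (y - x\<^sub>0))"
proof (rule measure_eqI)
  note [measurable] = affine_fun_measurable[OF l] C F(1)
  let ?a = "l x\<^sub>0" and ?\<sigma> = "hyperplane_measure l"
  let ?M = "cone_base_measure l F" and ?N = "cone_radius_measure DIM('a) (l x\<^sub>0)"
  interpret M: finite_measure ?M by (rule finite_cone_base_measure[OF l F])
  interpret N: finite_measure ?N by (rule finite_cone_radius_measure) (use a in simp)
  interpret MN: pair_sigma_finite ?M ?N ..
  fix A assume "A \<in> sets (density lborel (indicator C))"
  then have [measurable]: "A \<in> sets borel" by simp
  have "emeasure (density lborel (indicator C)) A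
      = (\<integral>\<^sup>+x. indicator {0..<?a} (l x) * indicator (C \<inter> A) x \<partial>lborel)"
    using AE_lborel_singleton[of x\<^sub>0] C_ge C_less
    by (subst emeasure_density) (auto intro!: nn_integral_cong_AE simp: indicator_def)
  also have "\<dots> = (\<integral>\<^sup>+t. indicator {0<..1} t * (ennreal (?a * t ^ (DIM('a) - 1)) *
        (\<integral>\<^sup>+y. indicator (C \<inter> A) (x\<^sub>0 + t *\<^sub>R (y - x\<^sub>0)) \<partial>?\<sigma>)) \<partial>lborel)"
    by (rule nn_integral_cone_coordinates[OF l u _ a]) measurable
  also have "\<dots> = (\<integral>\<^sup>+t. ennreal (indicator {0..1} t * (?a * t ^ (DIM('a) - 1))) *
        emeasure ?M {y. x\<^sub>0 + t *\<^sub>R (y - x\<^sub>0) \<in> A} \<partial>lborel)"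
  proof (intro nn_integral_cong_AE, use AE_lborel_singleton[of "0::real"] in eventually_elim)
    case (elim t)
    show ?case
    proof (cases "t \<in> {0<..1}")
      case True
      have "(\<integral>\<^sup>+y. indicator (C \<inter> A) (x\<^sub>0 + t *\<^sub>R (y - x\<^sub>0)) \<partial>?\<sigma>)
          = (\<integral>\<^sup>+y. indicator F y * indicator {y. x\<^sub>0 + t *\<^sub>R (y - x\<^sub>0) \<in> A} y \<partial>?\<sigma>)"
        using AE_hyperplane_measure[OF l u] True CF
        by (intro nn_integral_cong_AE) (auto elim!: eventually_mono simp: indicator_def)
      also have "\<dots> = emeasure ?M {y. x\<^sub>0 + t *\<^sub>R (y - x\<^sub>0) \<in> A}"
      proof -
        have "{y \<in> space borel. x\<^sub>0 + t *\<^sub>R (y - x\<^sub>0) \<in> A} \<in> sets borel" by measurable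
        then show ?thesis unfolding cone_base_measure_def by (subst emeasure_density) auto
      qed
      finally show ?thesis using True by simp
    qed (use elim in \<open>auto simp: indicator_def\<close>)
  qed
  also have "\<dots> = (\<integral>\<^sup>+t. emeasure ?M {y. x\<^sub>0 + t *\<^sub>R (y - x\<^sub>0) \<in> A} \<partial>?N)"
  proof -
    have "{z \<in> space (?M \<Otimes>\<^sub>M ?N). x\<^sub>0 + snd z *\<^sub>R (fst z - x\<^sub>0) \<in> A} \<in> sets (?M \<Otimes>\<^sub>M ?N)"
      by measurable
    from MN.measurable_emeasure_Pair2[OF this]
    have "(\<lambda>t. emeasure ?M {y. x\<^sub>0 + t *\<^sub>R (y - x\<^sub>0) \<in> A}) \<in> borel_measurable ?N"
      by (simp add: space_pair_measure vimage_def cone_radius_measure_def)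
    then have "(\<lambda>t. emeasure ?M {y. x\<^sub>0 + t *\<^sub>R (y - x\<^sub>0) \<in> A}) \<in> borel_measurable borel"
      by (simp add: cone_radius_measure_def)
    then show ?thesis
      unfolding cone_radius_measure_def by (subst nn_integral_density) auto
  qed
  also have "\<dots> = emeasure (?M \<Otimes>\<^sub>M ?N) ((\<lambda>(y, t). x\<^sub>0 + t *\<^sub>R (y - x\<^sub>0)) -` A \<inter> space (?M \<Otimes>\<^sub>M ?N))"
  proof (subst MN.emeasure_pair_measure_alt2)
    show "(\<lambda>(y, t). x\<^sub>0 + t *\<^sub>R (y - x\<^sub>0)) -` A \<inter> space (?M \<Otimes>\<^sub>M ?N) \<in> sets (?M \<Otimes>\<^sub>M ?N)"
      by (rule measurable_sets[where A = borel]) measurable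
  qed (auto simp: vimage_def space_pair_measure cone_radius_measure_def)
  also have "\<dots> = emeasure (distr (?M \<Otimes>\<^sub>M ?N) borel (\<lambda>(y, t). x\<^sub>0 + t *\<^sub>R (y - x\<^sub>0))) A"
    by (subst emeasure_distr) auto
  finally show "emeasure (density lborel (indicator C)) A
      = emeasure (distr (?M \<Otimes>\<^sub>M ?N) borel (\<lambda>(y, t). x\<^sub>0 + t *\<^sub>R (y - x\<^sub>0))) A" .
qed simp

section \<open>Affine and convex functions on Euclidean space\<close>

lemma continuous_on_affine_fun:
  fixes l :: "'a::euclidean_space \<Rightarrow> real"
  assumes "affine_fun l" shows "continuous_on A l"
proof -
  obtain a where "\<And>x. l x = a \<bullet> x + l 0" using affine_fun_inner[OF assms] by blast
  then have "l = (\<lambda>x. a \<bullet> x + l 0)" by (rule ext)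
  moreover have "continuous_on A (\<lambda>x. a \<bullet> x + l 0)" by (intro continuous_intros)
  ultimately show ?thesis by metis
qed

lemma affine_fun_segment:
  assumes "affine_fun l"
  shows "l (x + t *\<^sub>R (y - x)) = (1 - t) * l x + t * l y"
proof -
  have "l (y - x) - l 0 = l y - l x" using affine_fun_add[OF assms, of x "y - x"] by simp
  then have "l (x + t *\<^sub>R (y - x)) = l x + t * (l y - l x)"
    using affine_fun_add_scale[OF assms, of x t "y - x"] by simp
  then show ?thesis by (simp add: algebra_simps)
qed

text \<open>The strict epigraph of \<open>f\<close>, translated so that \<open>(x\<^sub>0, f x\<^sub>0)\<close> becomes the origin, is convex and omits
  the origin. A separating hyperplane is not vertical because \<open>x\<^sub>0\<close> is an interior point.\<close>

lemma convex_on_supporting_affine: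
  fixes f :: "'a::euclidean_space \<Rightarrow> real"
  assumes f: "convex_on P f" and x\<^sub>0: "x\<^sub>0 \<in> interior P"
  obtains a where "\<And>x. x \<in> P \<Longrightarrow> f x\<^sub>0 + a \<bullet> (x - x\<^sub>0) \<le> f x"
proof -
  define E where "E = {z. x\<^sub>0 + fst z \<in> P \<and> f (x\<^sub>0 + fst z) < f x\<^sub>0 + snd z}"
  have "convex E"
    unfolding convex_alt
  proof (intro ballI allI impI)
    fix y z u assume y: "y \<in> E" and z: "z \<in> E" and u: "0 \<le> u \<and> u \<le> (1::real)"
    have conv: "x\<^sub>0 + fst ((1 - u) *\<^sub>R y + u *\<^sub>R z) = (1 - u) *\<^sub>R (x\<^sub>0 + fst y) + u *\<^sub>R (x\<^sub>0 + fst z)"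
      by (simp add: algebra_simps)
    have "f ((1 - u) *\<^sub>R (x\<^sub>0 + fst y) + u *\<^sub>R (x\<^sub>0 + fst z))
        \<le> (1 - u) * f (x\<^sub>0 + fst y) + u * f (x\<^sub>0 + fst z)"
      using y z u by (intro convex_onD[OF f]) (auto simp: E_def)
    also have "\<dots> < (1 - u) * (f x\<^sub>0 + snd y) + u * (f x\<^sub>0 + snd z)"
      using convex_bound_lt[of "f (x\<^sub>0 + fst y) - (f x\<^sub>0 + snd y)" 0 "f (x\<^sub>0 + fst z) - (f x\<^sub>0 + snd z)" "1 - u" u] y z u
      by (simp add: E_def algebra_simps)
    also have "\<dots> = f x\<^sub>0 + snd ((1 - u) *\<^sub>R y + u *\<^sub>R z)" by (simp add: algebra_simps)
    finally show "(1 - u) *\<^sub>R y + u *\<^sub>R z \<in> E"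
      unfolding E_def mem_Collect_eq conv
      using convexD_alt[OF convex_on_imp_convex[OF f], of "x\<^sub>0 + fst y" "x\<^sub>0 + fst z" u] y z u
      by (simp add: E_def)
  qed
  moreover have "0 \<notin> E" by (simp add: E_def)
  ultimately obtain z where z: "z \<noteq> 0" "\<And>y. y \<in> E \<Longrightarrow> 0 \<le> z \<bullet> y"
    using separating_hyperplane_set_0 by metis
  obtain p q where pq: "z = (p, q)" by (cases z)
  have *: "0 \<le> p \<bullet> (x - x\<^sub>0) + q * s" if "x \<in> P" "f x < f x\<^sub>0 + s" for x s
    using z(2)[of "(x - x\<^sub>0, s)"] that by (simp add: pq E_def)
  have xP: "x\<^sub>0 \<in> P" using x\<^sub>0 interior_subset by blast
  obtain r where r: "r > 0" "cball x\<^sub>0 r \<subseteq> P" using x\<^sub>0 by (auto simp: mem_interior_cball)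
  have q0: "0 \<le> q" using *[OF xP, of 1] by simp
  have "q \<noteq> 0"
  proof
    assume q: "q = 0"
    then have p: "p \<noteq> 0" using z(1) pq by (simp add: zero_prod_def)
    \<comment> \<open>Moving from \<open>x\<^sub>0\<close> against a nonzero \<open>p\<close> stays in \<open>P\<close> and makes the functional negative.\<close>
    let ?x = "x\<^sub>0 - (r / norm p) *\<^sub>R p"
    have "?x \<in> P" using r p by (intro subsetD[OF r(2)]) (simp add: dist_norm)
    moreover have "f ?x < f x\<^sub>0 + (f ?x - f x\<^sub>0 + 1)" by simp
    ultimately have "0 \<le> p \<bullet> (?x - x\<^sub>0)" using *[of ?x "f ?x - f x\<^sub>0 + 1"] q by simp
    moreover have "\<not> p \<bullet> p \<le> 0" using p by (simp only: not_le inner_gt_zero_iff) simp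
    ultimately show False using r(1) p by (simp add: mult_le_0_iff divide_le_0_iff)
  qed
  with q0 have q: "q > 0" by simp
  have "f x\<^sub>0 + (- (1 / q) *\<^sub>R p) \<bullet> (x - x\<^sub>0) \<le> f x" if "x \<in> P" for x
  proof (rule field_le_epsilon)
    fix e :: real assume "e > 0"
    then have "0 \<le> p \<bullet> (x - x\<^sub>0) + q * (f x - f x\<^sub>0 + e)" using *[OF that, of "f x - f x\<^sub>0 + e"] by simp
    then have "0 \<le> (p \<bullet> (x - x\<^sub>0) + q * (f x - f x\<^sub>0 + e)) / q" using q by simp
    also have "\<dots> = (1 / q) * (p \<bullet> (x - x\<^sub>0)) + (f x - f x\<^sub>0 + e)" using q by (simp add: field_simps)
    finally show "f x\<^sub>0 + (- (1 / q) *\<^sub>R p) \<bullet> (x - x\<^sub>0) \<le> f x + e" by simp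
  qed
  then show ?thesis using that by blast
qed

text \<open>Place a box around \<open>x\<close> inside the open convex hull, and express each of its finitely many vertices by
  finitely many points of \<open>S\<close>.\<close>

lemma finite_hull_neighbourhood:
  fixes S :: "'a::euclidean_space set"
  assumes "open S" "x \<in> convex hull S"
  obtains T r where "finite T" "T \<subseteq> S" "r > 0" "cball x r \<subseteq> convex hull T"
proof -
  obtain a b where ab: "cbox a b \<subseteq> convex hull S" "x \<in> box a b"
    using open_contains_cbox[OF open_convex_hull[OF assms(1)] assms(2)] by metis
  obtain K where K: "finite K" "cbox a b = convex hull K"
    using polytope_interval[of a b] unfolding polytope_def by blast
  have "\<exists>T. finite T \<and> T \<subseteq> S \<and> k \<in> convex hull T" if "k \<in> K" for k
  proof -
    have "k \<in> convex hull S" using hull_inc[of k K convex] that K(2) ab(1) by blast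
    then show ?thesis by (subst (asm) caratheodory) auto
  qed
  then obtain T where T: "\<And>k. k \<in> K \<Longrightarrow> finite (T k) \<and> T k \<subseteq> S \<and> k \<in> convex hull (T k)" by metis
  have "K \<subseteq> convex hull (\<Union>k\<in>K. T k)"
    using T hull_mono[of "T _" "\<Union>k\<in>K. T k" convex] by (meson UN_upper subsetD subsetI)
  then have "box a b \<subseteq> convex hull (\<Union>k\<in>K. T k)"
    using K(2) box_subset_cbox[of a b] by (metis hull_minimal convex_convex_hull subset_trans)
  moreover obtain r where "r > 0" "cball x r \<subseteq> box a b"
    using ab(2) open_box open_contains_cball by blast
  ultimately show ?thesis
    using that[of "\<Union>k\<in>K. T k" r] K(1) T by auto
qed

text \<open>The reflection \<open>x \<mapsto> 2 c - x\<close> preserves the ball and Lebesgue measure, and midpoint convexity gives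
  \<open>2 g(c) \<le> g(x) + g(2 c - x)\<close>.\<close>

lemma set_integral_cball_ge_centre:
  fixes g :: "'a::euclidean_space \<Rightarrow> real"
  assumes g: "convex_on (cball c r) g" and cont: "continuous_on (cball c r) g"
  shows "measure lborel (cball c r) * g c \<le> (LINT x:cball c r|lborel. g x)"
proof -
  let ?B = "cball c r"
  let ?G = "\<lambda>x. indicator ?B x *\<^sub>R g x" and ?R = "\<lambda>x. 2 *\<^sub>R c + (- 1) *\<^sub>R x"
  have int: "integrable lborel ?G" by (rule borel_integrable_compact[OF compact_cball cont])
  have "(lborel :: 'a measure) = density (distr lborel borel ?R) (\<lambda>_. ennreal (\<bar>- 1\<bar> ^ DIM('a)))"
    by (rule lborel_affine) simp
  then have refl: "distr lborel borel ?R = (lborel :: 'a measure)" by (simp add: density_1)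
  have R_meas: "?R \<in> lborel \<rightarrow>\<^sub>M borel" by measurable
  have G_meas: "?G \<in> borel_measurable borel" using borel_measurable_integrable[OF int] by simp
  have int': "integrable lborel (\<lambda>x. ?G (?R x))"
    using int integrable_distr_eq[OF R_meas G_meas] unfolding refl by blast
  have eq: "integral\<^sup>L lborel (\<lambda>x. ?G (?R x)) = integral\<^sup>L lborel ?G"
    using integral_distr[OF R_meas G_meas] unfolding refl by (rule sym)
  have "2 * (measure lborel ?B * g c) = integral\<^sup>L lborel (\<lambda>x. indicator ?B x *\<^sub>R (2 * g c))"
    by simp
  also have "\<dots> \<le> integral\<^sup>L lborel (\<lambda>x. ?G x + ?G (?R x))"
  proof (rule integral_mono)
    show "integrable lborel (\<lambda>x. indicator ?B x *\<^sub>R (2 * g c))"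
      by (intro borel_integrable_compact compact_cball continuous_on_const)
    show "integrable lborel (\<lambda>x. ?G x + ?G (?R x))" using int int' by (rule Bochner_Integration.integrable_add)
    fix x
    have R: "?R x \<in> ?B \<longleftrightarrow> x \<in> ?B"
      by (simp add: dist_norm norm_minus_commute scaleR_2 algebra_simps)
    show "indicator ?B x *\<^sub>R (2 * g c) \<le> ?G x + ?G (?R x)"
    proof (cases "x \<in> ?B")
      case True
      have "c = (1 - 1/2) *\<^sub>R x + (1/2) *\<^sub>R ?R x" by (simp add: algebra_simps)
      then have "g c \<le> (1 - 1/2) * g x + (1/2) * g (?R x)"
        using convex_onD[OF g, of "1/2" x "?R x"] True R by auto
      then show ?thesis using True R by simp
    next
      case False
      then show ?thesis using R by simp
    qed
  qed
  also have "\<dots> = integral\<^sup>L lborel ?G + integral\<^sup>L lborel ?G"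
    using int int' by (simp only: Bochner_Integration.integral_add eq)
  finally show ?thesis by (simp add: set_lebesgue_integral_def)
qed

section \<open>The cones over the facets\<close>

lemma set_integrable_compact_continuous:
  fixes f :: "'a::euclidean_space \<Rightarrow> real"
  assumes M: "sets M = sets borel" and K: "compact K" "emeasure M K < \<infinity>" and f: "continuous_on K f"
  shows "set_integrable M K f"
proof -
  have KM: "K \<in> sets M" using M K by (simp add: borel_compact)
  have "(\<lambda>x. indicator K x *\<^sub>R f x) \<in> borel_measurable borel"
    using K f by (intro borel_measurable_continuous_on_indicator) (auto simp: borel_compact)
  then have "(\<lambda>x. indicator K x *\<^sub>R f x) \<in> borel_measurable M"
    using M measurable_cong_sets by blast
  moreover obtain B where "\<And>x. x \<in> K \<Longrightarrow> norm (f x) \<le> B"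
    using compact_imp_bounded[OF compact_continuous_image[OF f K(1)]] by (auto simp: bounded_iff)
  ultimately have int: "integrable M (\<lambda>x. indicator K x *\<^sub>R (indicator K x *\<^sub>R f x))"
    using K KM by (intro integrableI_bounded_set_indicator[where B = B]) auto
  have "indicator K x *\<^sub>R (indicator K x *\<^sub>R f x) = indicator K x *\<^sub>R f x" for x
    by (simp add: indicator_def)
  then show ?thesis using int by (simp only: set_integrable_def)
qed

locale centred_polytope =
  fixes P :: "'a::euclidean_space set" and d :: nat and L :: "nat \<Rightarrow> 'a \<Rightarrow> real" and x\<^sub>0 :: 'a
  assumes labelled: "labelled_polytope P d L" and x\<^sub>0: "x\<^sub>0 \<in> interior P"
begin

abbreviation facet_measure :: "nat \<Rightarrow> 'a measure" where
  "facet_measure j \<equiv> hyperplane_measure (L j)"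

abbreviation cone :: "nat \<Rightarrow> 'a set" where
  "cone j \<equiv> facet_cone P L x\<^sub>0 j"

lemma P_eq: "P = {x. \<forall>j\<in>{1..d}. L j x \<ge> 0}"
  using labelled unfolding labelled_polytope_def by blast

lemma affine_L: "j \<in> {1..d} \<Longrightarrow> affine_fun (L j)"
  using labelled by (simp add: labelled_polytope_def)

lemma continuous_L: "j \<in> {1..d} \<Longrightarrow> continuous_on A (L j)"
  by (intro continuous_on_affine_fun affine_L)

lemma L_ray: "j \<in> {1..d} \<Longrightarrow> L j (x\<^sub>0 + t *\<^sub>R (y - x\<^sub>0)) = (1 - t) * L j x\<^sub>0 + t * L j y"
  by (intro affine_fun_segment affine_L)

lemma compact_P: "compact P" and convex_P: "convex P" and bounded_P: "bounded P" and closed_P: "closed P"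
  using labelled unfolding labelled_polytope_def
  by (auto intro: polytope_imp_compact polytope_imp_convex polytope_imp_bounded polytope_imp_closed)

lemma x\<^sub>0_P: "x\<^sub>0 \<in> P"
  using x\<^sub>0 interior_subset by blast

lemma ray_in_P: "y \<in> P \<Longrightarrow> 0 \<le> t \<Longrightarrow> t \<le> 1 \<Longrightarrow> x\<^sub>0 + t *\<^sub>R (y - x\<^sub>0) \<in> P"
  using convexD_alt[OF convex_P x\<^sub>0_P, of y t] by (simp add: algebra_simps)

lemma ray_cont:
  fixes h :: "'a \<Rightarrow> real"
  assumes "continuous_on P h" "y \<in> P"
  shows "continuous_on {0..1} (\<lambda>t. h (x\<^sub>0 + t *\<^sub>R (y - x\<^sub>0)))"
  by (intro continuous_on_compose2[OF assms(1)] continuous_intros) (use ray_in_P[OF assms(2)] in auto)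

lemma convex_along_ray:
  assumes g: "convex_on P g" and y: "y \<in> P"
  shows "convex_on {0..1} (\<lambda>t. g (x\<^sub>0 + t *\<^sub>R (y - x\<^sub>0)))"
proof (rule convex_onI)
  fix u s t :: real assume u: "0 < u" "u < 1" and st: "s \<in> {0..1}" "t \<in> {0..1}"
  have "x\<^sub>0 + ((1 - u) *\<^sub>R s + u *\<^sub>R t) *\<^sub>R (y - x\<^sub>0)
      = (1 - u) *\<^sub>R (x\<^sub>0 + s *\<^sub>R (y - x\<^sub>0)) + u *\<^sub>R (x\<^sub>0 + t *\<^sub>R (y - x\<^sub>0))"
    by (simp add: algebra_simps)
  then show "g (x\<^sub>0 + ((1 - u) *\<^sub>R s + u *\<^sub>R t) *\<^sub>R (y - x\<^sub>0))
      \<le> (1 - u) * g (x\<^sub>0 + s *\<^sub>R (y - x\<^sub>0)) + u * g (x\<^sub>0 + t *\<^sub>R (y - x\<^sub>0))"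
    using convex_onD[OF g, of u] u st ray_in_P[OF y] by auto
qed simp

lemma L_interior_pos:
  assumes j: "j \<in> {1..d}" and x: "x \<in> interior P"
  shows "L j x > 0"
proof (rule ccontr)
  assume "\<not> L j x > 0"
  obtain z where z: "L j z < 0" using labelled_polytope_minimal[OF labelled j] by blast
  obtain r where r: "r > 0" "ball x r \<subseteq> P" using x by (auto simp: mem_interior)
  define N where "N = norm (z - x)"
  define s where "s = r / (2 * (N + 1))"
  have N: "N \<ge> 0" by (simp add: N_def)
  have "r * N < r * (2 * (N + 1))" using r(1) N by (intro mult_strict_left_mono) auto
  then have s: "s > 0" "s * norm (z - x) < r"
    using r(1) N by (auto simp: s_def N_def[symmetric] pos_divide_less_eq)
  then have "x + s *\<^sub>R (z - x) \<in> P" using r(2) by (auto simp: dist_norm)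
  then have "L j (x + s *\<^sub>R (z - x)) \<ge> 0" using P_eq j by auto
  moreover have "L j (x + s *\<^sub>R (z - x)) = (1 - s) * L j x + s * L j z"
    by (intro affine_fun_segment affine_L j)
  moreover have "L j x = 0" using \<open>\<not> L j x > 0\<close> x interior_subset[of P] P_eq j by force
  ultimately show False using s(1) z by (simp add: zero_le_mult_iff)
qed

lemma L_x\<^sub>0: "j \<in> {1..d} \<Longrightarrow> L j x\<^sub>0 > 0"
  using L_interior_pos x\<^sub>0 by blast

lemma transversal:
  assumes j: "j \<in> {1..d}"
  obtains u where "L j u - L j 0 = 1"
proof -
  obtain z where z: "L j z < 0" using labelled_polytope_minimal[OF labelled j] by blast
  define c where "c = L j x\<^sub>0 - L j z"
  have c: "c > 0" using z L_x\<^sub>0[OF j] by (simp add: c_def)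
  have "L j (x\<^sub>0 - z) - L j 0 = c"
    using affine_fun_add[OF affine_L[OF j], of z "x\<^sub>0 - z"] by (simp add: c_def)
  then have "L j ((1 / c) *\<^sub>R (x\<^sub>0 - z)) - L j 0 = 1"
    using c affine_fun_scale[OF affine_L[OF j], of "1 / c" "x\<^sub>0 - z"] by simp
  then show ?thesis using that by blast
qed

lemma facet_subset: "facet P L j \<subseteq> P"
  by (auto simp: facet_def)

lemma compact_facet:
  assumes "j \<in> {1..d}" shows "compact (facet P L j)"
proof -
  have "closed {x. L j x = 0}"
    using continuous_L[OF assms, of UNIV] by (intro closed_Collect_eq) auto
  then have "compact (P \<inter> {x. L j x = 0})" using compact_P by (rule compact_Int_closed[rotated])
  moreover have "facet P L j = P \<inter> {x. L j x = 0}" by (auto simp: facet_def)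
  ultimately show ?thesis by simp
qed

lemma frontier_eq: "frontier P = (\<Union>j\<in>{1..d}. facet P L j)"
proof (intro equalityI subsetI)
  fix x assume x: "x \<in> frontier P"
  then have "x \<in> P" "x \<notin> interior P" using closed_P by (auto simp: frontier_def)
  have "open (\<Inter>j\<in>{1..d}. {x. 0 < L j x})"
    using continuous_L[of _ UNIV] by (intro open_INT ballI open_Collect_less) auto
  moreover have "(\<Inter>j\<in>{1..d}. {x. 0 < L j x}) \<subseteq> P" by (subst P_eq) (auto simp: less_imp_le)
  ultimately have "(\<Inter>j\<in>{1..d}. {x. 0 < L j x}) \<subseteq> interior P" by (rule interior_maximal[rotated])
  then obtain j where "j \<in> {1..d}" "\<not> 0 < L j x" using \<open>x \<notin> interior P\<close> by blast
  moreover have "0 \<le> L j x" using \<open>x \<in> P\<close> P_eq calculation(1) by auto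
  ultimately show "x \<in> (\<Union>j\<in>{1..d}. facet P L j)" using \<open>x \<in> P\<close> by (force simp: facet_def)
next
  fix x assume "x \<in> (\<Union>j\<in>{1..d}. facet P L j)"
  then show "x \<in> frontier P"
    using closed_P L_interior_pos by (fastforce simp: facet_def frontier_def)
qed

text \<open>The base is convex, so no proper convex combination of several of its points is needed.\<close>

lemma cone_cases:
  assumes j: "j \<in> {1..d}" and x: "x \<in> cone j"
  obtains "x = x\<^sub>0" | y t where "y \<in> facet P L j" "0 < t" "t \<le> 1" "x = x\<^sub>0 + t *\<^sub>R (y - x\<^sub>0)"
proof (cases "facet P L j = {}")
  case True
  then show ?thesis using x that(1) by (simp add: facet_cone_def)
next
  case False
  obtain a where a: "\<And>x. L j x = a \<bullet> x + L j 0" using affine_fun_inner[OF affine_L[OF j]] by blast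
  have "L j x = 0 \<longleftrightarrow> a \<bullet> x = - L j 0" for x using a[of x] by linarith
  then have "facet P L j = P \<inter> {x. a \<bullet> x = - L j 0}" by (auto simp: facet_def)
  then have "convex hull (facet P L j) = facet P L j"
    by (simp add: convex_Int convex_P convex_hyperplane hull_same)
  then obtain s t y where y: "0 \<le> s" "0 \<le> t" "s + t = 1" "y \<in> facet P L j" "x = s *\<^sub>R x\<^sub>0 + t *\<^sub>R y"
    using x unfolding facet_cone_def convex_hull_insert[OF False] by auto
  have s: "s = 1 - t" using y by simp
  have "x = x\<^sub>0 + t *\<^sub>R (y - x\<^sub>0)" unfolding y(5) s by (simp add: algebra_simps)
  then show ?thesis using y(1-4) that(1) that(2)[of y t] by (cases "t = 0") auto
qed


lemma cone_ray:
  assumes j: "j \<in> {1..d}" and y: "L j y = 0" and t: "0 < t" "t \<le> 1"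
  shows "x\<^sub>0 + t *\<^sub>R (y - x\<^sub>0) \<in> cone j \<longleftrightarrow> y \<in> facet P L j"
proof
  assume y: "y \<in> facet P L j"
  have "(1 - t) *\<^sub>R x\<^sub>0 + t *\<^sub>R y \<in> cone j"
    unfolding facet_cone_def using t y
    by (intro convexD_alt[OF convex_convex_hull]) (auto intro: hull_inc)
  then show "x\<^sub>0 + t *\<^sub>R (y - x\<^sub>0) \<in> cone j" by (simp add: algebra_simps)
next
  assume "x\<^sub>0 + t *\<^sub>R (y - x\<^sub>0) \<in> cone j" (is "?x \<in> _")
  with j show "y \<in> facet P L j"
  proof (cases rule: cone_cases)
    case 1
    then have "y = x\<^sub>0" using t by simp
    then show ?thesis using y L_x\<^sub>0[OF j] by simp
  next
    case (2 z s)
    have "L j z = 0" using 2(1) by (simp add: facet_def)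
    then have "(1 - t) * L j x\<^sub>0 = (1 - s) * L j x\<^sub>0"
      using arg_cong[OF 2(4), of "L j"] y by (simp add: L_ray[OF j])
    then have "s = t" using L_x\<^sub>0[OF j] by simp
    then show ?thesis using 2(1,4) t by simp
  qed
qed

lemma cone_ray_mem: "j \<in> {1..d} \<Longrightarrow> y \<in> facet P L j \<Longrightarrow> 0 < t \<Longrightarrow> t \<le> 1 \<Longrightarrow> x\<^sub>0 + t *\<^sub>R (y - x\<^sub>0) \<in> cone j"
  using cone_ray by (simp add: facet_def)

lemma compact_cone: "j \<in> {1..d} \<Longrightarrow> compact (cone j)"
  unfolding facet_cone_def by (intro compact_convex_hull compact_insert compact_facet)

lemma convex_cone: "convex (cone j)"
  unfolding facet_cone_def by (rule convex_convex_hull)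

lemma x\<^sub>0_cone: "x\<^sub>0 \<in> cone j"
  unfolding facet_cone_def by (simp add: hull_inc)

lemma cone_subset: "cone j \<subseteq> P"
  unfolding facet_cone_def using x\<^sub>0_P facet_subset convex_P by (intro hull_minimal) auto

text \<open>A ray from \<open>x\<^sub>0\<close> through a point of \<open>P\<close> leaves the interior of \<open>P\<close> at a point of some facet.\<close>

lemma P_eq_Union_cone: "P = (\<Union>j\<in>{1..d}. cone j)"
proof (intro equalityI subsetI)
  have frontier_ray: "\<exists>j\<in>{1..d}. \<exists>s>0. x\<^sub>0 + s *\<^sub>R (x - x\<^sub>0) \<in> facet P L j \<and> (x \<in> P \<longrightarrow> 1 \<le> s)"
    if "x \<noteq> x\<^sub>0" for x
  proof -
    have "x - x\<^sub>0 \<noteq> 0" using that by simp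
    from ray_to_frontier[OF bounded_P x\<^sub>0 this]
    obtain s where s: "0 < s" "x\<^sub>0 + s *\<^sub>R (x - x\<^sub>0) \<in> frontier P" by blast
    have "1 \<le> s" if "x \<in> P"
    proof (rule ccontr)
      assume "\<not> 1 \<le> s"
      then have "x - (1 - s) *\<^sub>R (x - x\<^sub>0) \<in> interior P"
        using s(1) that by (intro mem_interior_convex_shrink[OF convex_P x\<^sub>0]) auto
      moreover have "x - (1 - s) *\<^sub>R (x - x\<^sub>0) = x\<^sub>0 + s *\<^sub>R (x - x\<^sub>0)" by (simp add: algebra_simps)
      ultimately show False using s(2) by (simp add: frontier_def)
    qed
    then show ?thesis using s frontier_eq by auto
  qed
  fix x assume x: "x \<in> P"
  show "x \<in> (\<Union>j\<in>{1..d}. cone j)"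
  proof (cases "x = x\<^sub>0")
    case True
    obtain b :: 'a where "b \<in> Basis" using nonempty_Basis by blast
    then have "x\<^sub>0 + b \<noteq> x\<^sub>0" using nonzero_Basis by simp
    then obtain j where "j \<in> {1..d}" using frontier_ray by blast
    then show ?thesis using True x\<^sub>0_cone by blast
  next
    case False
    then obtain j s where s: "j \<in> {1..d}" "1 \<le> s" "x\<^sub>0 + s *\<^sub>R (x - x\<^sub>0) \<in> facet P L j"
      using frontier_ray x by blast
    have "x\<^sub>0 + (1 / s) *\<^sub>R (x\<^sub>0 + s *\<^sub>R (x - x\<^sub>0) - x\<^sub>0) \<in> cone j"
      using s by (intro cone_ray_mem) auto
    then show ?thesis using s by auto
  qed
qed (use cone_subset in blast)

text \<open>On \<open>C\<^sub>j\<close> the index \<open>j\<close> minimises \<open>L\<^sub>i(x) / L\<^sub>i(x\<^sub>0)\<close>, so the overlap lies where two of these quotients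
  agree. This is a hyperplane, since otherwise \<open>L\<^sub>j\<close> and \<open>L\<^sub>k\<close> would be positive multiples of each other and
  the labelling would not be minimal.\<close>

lemma cone_overlap_null:
  assumes j: "j \<in> {1..d}" and k: "k \<in> {1..d}" and "j \<noteq> k"
  shows "cone j \<inter> cone k \<in> null_sets lborel"
proof -
  obtain a where a: "\<And>x. L j x = a \<bullet> x + L j 0" using affine_fun_inner[OF affine_L[OF j]] by blast
  obtain b where b: "\<And>x. L k x = b \<bullet> x + L k 0" using affine_fun_inner[OF affine_L[OF k]] by blast
  \<comment> \<open>The hyperplane \<open>L\<^sub>j / L\<^sub>j(x\<^sub>0) = L\<^sub>k / L\<^sub>k(x\<^sub>0)\<close> in normal form.\<close>
  define c where "c = L k x\<^sub>0 *\<^sub>R a - L j x\<^sub>0 *\<^sub>R b"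
  define e where "e = L j x\<^sub>0 * L k 0 - L k x\<^sub>0 * L j 0"
  have diff: "L k x\<^sub>0 * L j x - L j x\<^sub>0 * L k x = c \<bullet> x - e" for x
  proof -
    have "L k x\<^sub>0 * L j x - L j x\<^sub>0 * L k x
        = L k x\<^sub>0 * (a \<bullet> x + L j 0) - L j x\<^sub>0 * (b \<bullet> x + L k 0)"
      using a[of x] b[of x] by simp
    also have "\<dots> = c \<bullet> x - e" by (simp add: c_def e_def algebra_simps)
    finally show ?thesis .
  qed
  have "c \<noteq> 0"
  proof
    assume "c = 0"
    obtain z where z: "\<And>i. i \<in> {1..d} - {k} \<Longrightarrow> L i z \<ge> 0" "L k z < 0"
      using labelled_polytope_minimal[OF labelled k] by blast
    have "L j z \<ge> 0" using z(1) j \<open>j \<noteq> k\<close> by auto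
    then have "L k x\<^sub>0 * L j z \<ge> 0" "L j x\<^sub>0 * L k z < 0"
      using L_x\<^sub>0[OF j] L_x\<^sub>0[OF k] z(2) by (auto simp: mult_pos_neg)
    then show False using diff[of z] diff[of x\<^sub>0] \<open>c = 0\<close> by simp
  qed
  have cmp: "L j x * L i x\<^sub>0 \<le> L i x * L j x\<^sub>0" if i: "i \<in> {1..d}" and j: "j \<in> {1..d}" and "x \<in> cone j" for i j x
    using j that(3)
  proof (cases rule: cone_cases)
    case 1
    then show ?thesis by simp
  next
    case (2 y t)
    have "L j y = 0" "0 \<le> L i y" using 2(1) P_eq i by (auto simp: facet_def)
    then have "0 \<le> t * L i y * L j x\<^sub>0" using 2(2) L_x\<^sub>0[OF j] by simp
    moreover have "L j x = (1 - t) * L j x\<^sub>0" "L i x = (1 - t) * L i x\<^sub>0 + t * L i y"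
      unfolding 2(4) L_ray[OF i] L_ray[OF j] \<open>L j y = 0\<close> by simp_all
    ultimately show ?thesis by (simp only: distrib_right) (simp add: mult_ac)
  qed
  have "L j x * L k x\<^sub>0 = L k x * L j x\<^sub>0" if "x \<in> cone j \<inter> cone k" for x
    using that cmp[OF k j, of x] cmp[OF j k, of x] by simp
  then have "c \<bullet> x = e" if "x \<in> cone j \<inter> cone k" for x
    using that diff[of x] by (simp add: mult.commute)
  then have sub: "cone j \<inter> cone k \<subseteq> {x. c \<bullet> x = e}" by blast
  have "{x. c \<bullet> x = e} \<in> null_sets lborel"
    using negligible_hyperplane[of c e] \<open>c \<noteq> 0\<close>
    by (simp add: negligible_iff_null_sets null_sets_completion_iff closed_hyperplane)
  then show ?thesis
    using sub borel_compact[OF compact_cone[OF j]] borel_compact[OF compact_cone[OF k]]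
    by (intro null_sets_subset[OF _ _ sub]) auto
qed

lemma set_integrable_continuous:
  fixes h :: "'a \<Rightarrow> real"
  assumes h: "continuous_on P h" and K: "compact K" "K \<subseteq> P"
  shows "set_integrable lborel K h"
  using K continuous_on_subset[OF h K(2)] emeasure_compact_finite[OF K(1)]
  by (intro set_integrable_compact_continuous) auto

lemma integral_P_eq_sum_cones:
  fixes h :: "'a \<Rightarrow> real"
  assumes h: "continuous_on P h"
  shows "(LINT x:P|lborel. h x) = (\<Sum>j\<in>{1..d}. LINT x:cone j|lborel. h x)"
proof -
  have "(LINT x:(\<Union>j\<in>{1..d}. cone j)|lborel. h x) = (\<Sum>j\<in>{1..d}. LINT x:cone j|lborel. h x)"
  proof (rule set_integral_finite_UN_AE)
    fix i j assume "i \<in> {1..d}" "j \<in> {1..d}"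
    then show "AE x in lborel. x \<in> cone i \<and> x \<in> cone j \<longrightarrow> i = j"
      using AE_not_in[OF cone_overlap_null[of i j]] by (cases "i = j") (auto elim: eventually_mono)
  qed (auto simp: borel_compact[OF compact_cone]
      intro!: set_integrable_continuous[OF h] compact_cone cone_subset)
  then show ?thesis unfolding P_eq_Union_cone[symmetric] .
qed

lemma facet_measure_finite: "j \<in> {1..d} \<Longrightarrow> emeasure (facet_measure j) (facet P L j) < \<infinity>"
  using emeasure_hyperplane_measure_bounded[OF affine_L] compact_facet
  by (simp add: borel_compact compact_imp_bounded)

lemma set_integrable_facet:
  fixes h :: "'a \<Rightarrow> real"
  assumes j: "j \<in> {1..d}" and h: "continuous_on P h"
  shows "set_integrable (facet_measure j) (facet P L j) h"
  using facet_measure_finite[OF j] compact_facet[OF j] continuous_on_subset[OF h facet_subset]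
  by (intro set_integrable_compact_continuous) auto

text \<open>Distinct facets meet in null sets of the boundary measure, which agrees on each facet with the
  measure of the corresponding hyperplane.\<close>

lemma integral_boundary_eq_sum_facets:
  fixes h :: "'a \<Rightarrow> real"
  assumes h: "continuous_on P h"
  shows "(LINT x:frontier P|labelled_boundary_measure P d L. h x)
    = (\<Sum>j\<in>{1..d}. LINT x:facet P L j|facet_measure j. h x)"
proof -
  let ?\<sigma> = "labelled_boundary_measure P d L"
  have borel: "facet P L j \<in> sets borel" if "j \<in> {1..d}" for j
    using compact_facet[OF that] by (rule borel_compact)
  have fin: "emeasure ?\<sigma> (facet P L j) < \<infinity>" if "j \<in> {1..d}" for j
    using labelled_boundary_measure_facet[OF labelled that borel[OF that] order_refl]
      facet_measure_finite[OF that] by simp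
  have "(LINT x:(\<Union>j\<in>{1..d}. facet P L j)|?\<sigma>. h x) = (\<Sum>j\<in>{1..d}. LINT x:facet P L j|?\<sigma>. h x)"
  proof (rule set_integral_finite_UN_AE)
    fix i j assume ij: "i \<in> {1..d}" "j \<in> {1..d}"
    have "facet P L i \<inter> facet P L j \<in> null_sets ?\<sigma>" if "i \<noteq> j"
    proof -
      have B: "facet P L i \<inter> facet P L j \<in> sets borel" using borel ij by auto
      have "emeasure ?\<sigma> (facet P L i \<inter> facet P L j) = 0"
        using labelled_boundary_measure_facet[OF labelled ij(1) B]
          facet_overlap_null[OF labelled ij that B] by simp
      then show ?thesis using B by auto
    qed
    then show "AE x in ?\<sigma>. x \<in> facet P L i \<and> x \<in> facet P L j \<longrightarrow> i = j"
      using AE_not_in by (cases "i = j") (fastforce elim: eventually_mono)+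
  next
    fix j assume j: "j \<in> {1..d}"
    show "facet P L j \<in> sets ?\<sigma>" using borel[OF j] by simp
    show "set_integrable ?\<sigma> (facet P L j) h"
      using fin[OF j] compact_facet[OF j] continuous_on_subset[OF h facet_subset]
      by (intro set_integrable_compact_continuous) auto
  qed auto
  moreover have "(LINT x:facet P L j|?\<sigma>. h x) = (LINT x:facet P L j|facet_measure j. h x)"
    if j: "j \<in> {1..d}" for j
  proof -
    let ?F = "facet P L j"
    have "density ?\<sigma> (indicator ?F) = density (facet_measure j) (indicator ?F)"
    proof (rule measure_eqI)
      fix A assume "A \<in> sets (density ?\<sigma> (indicator ?F))"
      then have A: "A \<inter> ?F \<in> sets borel" "A \<in> sets borel" using borel[OF j] by auto
      then have "emeasure ?\<sigma> (A \<inter> ?F) = emeasure (facet_measure j) (A \<inter> ?F)"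
        using labelled_boundary_measure_facet[OF labelled j] by blast
      then show "emeasure (density ?\<sigma> (indicator ?F)) A
          = emeasure (density (facet_measure j) (indicator ?F)) A"
        using A borel[OF j] by (simp add: emeasure_restricted Int_commute[of A])
    qed simp
    moreover have "(LINT x:?F|M. h x) = (LINT x|density M (indicator ?F). indicator ?F x *\<^sub>R h x)"
      if M: "sets M = sets borel" for M
    proof -
      have hM: "(\<lambda>x. indicator ?F x *\<^sub>R h x) \<in> borel_measurable M"
        using borel_measurable_continuous_on_indicator[OF borel[OF j] continuous_on_subset[OF h facet_subset]]
          measurable_cong_sets[OF M refl] by blast
      have [measurable]: "?F \<in> sets M" using borel[OF j] M by simp
      have "(LINT x|density M (\<lambda>x. ennreal (indicator ?F x)). indicator ?F x *\<^sub>R h x)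
          = (LINT x|M. indicator ?F x *\<^sub>R (indicator ?F x *\<^sub>R h x))"
        by (rule integral_density[OF hM]) auto
      also have "\<dots> = (LINT x:?F|M. h x)"
        unfolding set_lebesgue_integral_def by (rule Bochner_Integration.integral_cong) (auto simp: indicator_def)
      finally show ?thesis by (simp add: ennreal_indicator)
    qed
    ultimately show ?thesis by simp
  qed
  ultimately show ?thesis by (simp add: frontier_eq)
qed

definition ray_integral :: "('a \<Rightarrow> real) \<Rightarrow> 'a \<Rightarrow> real" where
  "ray_integral h y = integral {0..1} (\<lambda>t. t ^ (DIM('a) - 1) * h (x\<^sub>0 + t *\<^sub>R (y - x\<^sub>0)))"

lemma
  fixes h :: "'a \<Rightarrow> real"
  assumes j: "j \<in> {1..d}" and h: "continuous_on P h"
  shows cone_integral: "(LINT x:cone j|lborel. h x) = 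
      L j x\<^sub>0 * (LINT y:facet P L j|facet_measure j. ray_integral h y)" (is ?eq)
    and set_integrable_ray_integral: "set_integrable (facet_measure j) (facet P L j) (ray_integral h)"
      (is ?int)
proof -
  let ?F = "facet P L j" and ?C = "cone j" and ?a = "L j x\<^sub>0" and ?n = "DIM('a)"
  let ?M = "cone_base_measure (L j) ?F" and ?N = "cone_radius_measure ?n ?a"
  let ?T = "\<lambda>(y, t). x\<^sub>0 + t *\<^sub>R (y - x\<^sub>0)"
  \<comment> \<open>Extension by zero makes the integrand Borel measurable on the whole space.\<close>
  define h' where "h' x = indicator P x *\<^sub>R h x" for x
  define G where "G y = (LINT t|?N. h' (x\<^sub>0 + t *\<^sub>R (y - x\<^sub>0)))" for y
  have [measurable]: "?F \<in> sets borel" "?C \<in> sets borel" "P \<in> sets borel"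
    using compact_facet[OF j] compact_cone[OF j] compact_P by (auto intro: borel_compact)
  have [measurable]: "h' \<in> borel_measurable borel"
    unfolding h'_def by (rule borel_measurable_continuous_on_indicator[OF _ h]) simp
  obtain u where u: "L j u - L j 0 = 1" using transversal[OF j] by blast
  have a: "?a > 0" by (rule L_x\<^sub>0[OF j])
  interpret M: finite_measure ?M
    using compact_facet[OF j] by (intro finite_cone_base_measure affine_L[OF j]) (auto simp: compact_imp_bounded)
  interpret N: finite_measure ?N by (rule finite_cone_radius_measure) (use a in simp)
  interpret MN: pair_sigma_finite ?M ?N ..
  have D: "density lborel (indicator ?C) = distr (?M \<Otimes>\<^sub>M ?N) borel ?T"
  proof (rule density_cone_eq_distr[OF affine_L[OF j] u a])
    show "bounded ?F" using compact_facet[OF j] by (rule compact_imp_bounded)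
    show "0 \<le> L j x" if "x \<in> ?C" for x using that cone_subset[of j] P_eq j by auto
    show "L j x < ?a" if "x \<in> ?C" "x \<noteq> x\<^sub>0" for x
      using j that(1)
    proof (cases rule: cone_cases)
      case (2 y t)
      then have "L j x = (1 - t) * ?a" by (simp add: L_ray[OF j] facet_def)
      moreover have "0 < t * ?a" using 2(2) a by simp
      ultimately show ?thesis by (simp add: algebra_simps)
    qed (use that in simp)
    show "x\<^sub>0 + t *\<^sub>R (y - x\<^sub>0) \<in> ?C \<longleftrightarrow> y \<in> ?F" if "L j y = 0" "0 < t" "t \<le> 1" for y t
      using cone_ray[OF j that] .
  qed measurable
  have h'C: "indicator ?C x *\<^sub>R h' x = indicator ?C x *\<^sub>R h x" for x
    using cone_subset[of j] by (auto simp: h'_def indicator_def)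
  have "integrable lborel (\<lambda>x. indicator ?C x *\<^sub>R h' x)"
    using set_integrable_continuous[OF h compact_cone[OF j] cone_subset]
    unfolding set_integrable_def h'C .
  then have "integrable (density lborel (\<lambda>x. ennreal (indicator ?C x))) h'"
    by (subst integrable_density) auto
  then have "integrable (distr (?M \<Otimes>\<^sub>M ?N) borel ?T) h'" unfolding ennreal_indicator D .
  then have int: "integrable (?M \<Otimes>\<^sub>M ?N) (\<lambda>z. h' (?T z))"
    by (subst (asm) integrable_distr_eq) auto
  have G: "integrable ?M G" "(LINT y|?M. G y) = (LINT z|(?M \<Otimes>\<^sub>M ?N). h' (?T z))"
    using MN.integrable_fst'[OF int] MN.integral_fst'[OF int] by (simp_all add: G_def[abs_def])
  have [measurable]: "G \<in> borel_measurable borel"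
    using borel_measurable_integrable[OF G(1)] by (simp cong: measurable_cong_sets)
  have GF: "G y = ?a * ray_integral h y" if "y \<in> ?F" for y
  proof -
    have yP: "y \<in> P" using that facet_subset by blast
    have cont: "continuous_on {0..1} (\<lambda>t. ?a * t ^ (?n - 1) * h (x\<^sub>0 + t *\<^sub>R (y - x\<^sub>0)))"
      by (intro continuous_intros continuous_on_compose2[OF h]) (use ray_in_P[OF yP] in auto)
    have "G y = (LINT t|lborel. (indicator {0..1} t * (?a * t ^ (?n - 1))) *\<^sub>R h' (x\<^sub>0 + t *\<^sub>R (y - x\<^sub>0)))"
      unfolding G_def cone_radius_measure_def using a
      by (intro integral_density) (auto simp: indicator_def)
    also have "\<dots> = (LINT t:{0..1}|lborel. ?a * t ^ (?n - 1) * h (x\<^sub>0 + t *\<^sub>R (y - x\<^sub>0)))"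
      unfolding set_lebesgue_integral_def
      by (intro Bochner_Integration.integral_cong) (use ray_in_P[OF yP] in \<open>auto simp: h'_def indicator_def\<close>)
    also have "\<dots> = integral {0..1} (\<lambda>t. ?a * t ^ (?n - 1) * h (x\<^sub>0 + t *\<^sub>R (y - x\<^sub>0)))"
      using borel_integrable_compact[OF compact_Icc cont]
      by (intro set_borel_integral_eq_integral) (simp add: set_integrable_def)
    finally show ?thesis by (simp add: ray_integral_def mult.assoc)
  qed
  have M_eq: "?M = density (facet_measure j) (\<lambda>x. ennreal (indicator ?F x))"
    by (simp add: cone_base_measure_def ennreal_indicator)
  have "set_integrable (facet_measure j) ?F G"
    using G(1) unfolding M_eq set_integrable_def by (subst (asm) integrable_density) auto
  then have "set_integrable (facet_measure j) ?F (\<lambda>y. (1 / ?a) * G y)" by (rule set_integrable_mult_right)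
  then show ?int using GF a by (subst set_integrable_cong[OF refl refl, where f' = "\<lambda>y. (1 / ?a) * G y"]) auto
  have "(LINT x:?C|lborel. h x) = (LINT x|density lborel (\<lambda>x. ennreal (indicator ?C x)). h' x)"
    unfolding set_lebesgue_integral_def h'C[symmetric] by (rule integral_density[symmetric]) auto
  also have "\<dots> = (LINT y|?M. G y)"
    unfolding ennreal_indicator D G(2) by (rule integral_distr) auto
  also have "\<dots> = (LINT y:?F|facet_measure j. G y)"
    unfolding M_eq set_lebesgue_integral_def by (rule integral_density) auto
  also have "\<dots> = (LINT y:?F|facet_measure j. ?a * ray_integral h y)"
    using GF by (intro set_lebesgue_integral_cong) auto
  finally show ?eq by simp
qed

end

section \<open>The Donaldson-Futaki invariant in cone coordinates\<close>

text \<open>The differential on \<open>P\<close> does not depend on the extension, so it inherits continuity from the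
  derivative of any extension.\<close>

lemma C1_on_continuous_differential:
  fixes v :: "'a::euclidean_space \<Rightarrow> real"
  assumes v: "C1_on P v" and P: "convex P" "interior P \<noteq> {}"
  obtains V V' where "\<And>x. x \<in> P \<Longrightarrow> (V has_derivative blinfun_apply (V' x)) (at x)"
    "continuous_on P V'" "\<And>x. x \<in> P \<Longrightarrow> v x = V x"
    "\<And>x. x \<in> P \<Longrightarrow> differential_on P v x = blinfun_apply (V' x)"
proof -
  obtain U V and V' :: "'a \<Rightarrow> ('a \<Rightarrow>\<^sub>L real)" where
    U: "open U" "P \<subseteq> U" "\<And>x. x \<in> U \<Longrightarrow> (V has_derivative blinfun_apply (V' x)) (at x)"
    "continuous_on U V'" "\<And>x. x \<in> P \<Longrightarrow> v x = V x"
    using v unfolding C1_on_def by blast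
  have "differential_on P v x = blinfun_apply (V' x)" if "x \<in> P" for x
    using U that by (intro differential_on_eq[OF P that]) auto
  then show ?thesis
    using U continuous_on_subset[OF U(4,2)] by (intro that[of V V']) auto
qed

locale weighted_polytope = centred_polytope P d L x\<^sub>0
  for P :: "'a::euclidean_space set" and d L x\<^sub>0 +
  fixes v w :: "'a \<Rightarrow> real"
  assumes v_C1: "C1_on P v" and v_pos: "\<forall>x\<in>P. v x > 0" and w_cont: "continuous_on P w"
begin

text \<open>Along a ray \<open>x(t) = x\<^sub>0 + t (y - x\<^sub>0)\<close> this is the density in \<open>d/dt (t\<^bsup>n+1\<^esup> v(x(t))) = t\<^sup>n E(x(t))\<close>.\<close>

definition radial_density :: "'a \<Rightarrow> real" where
  "radial_density x = (real DIM('a) + 1) * v x + differential_on P v x (x - x\<^sub>0)"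

text \<open>The left-hand side of the inequality that is assumed on the cone with index \<open>j\<close>.\<close>

definition defect :: "nat \<Rightarrow> 'a \<Rightarrow> real" where
  "defect j x = radial_density x / L j x\<^sub>0 - w x / 2"

definition defect_integral :: "('a \<Rightarrow> real) \<Rightarrow> real" where
  "defect_integral g = (\<Sum>j\<in>{1..d}. LINT x:cone j|lborel. defect j x * g x)"

lemma interior_P: "interior P \<noteq> {}"
  using x\<^sub>0 by blast

lemma v_cont: "continuous_on P v"
proof -
  obtain V V' where V: "\<And>x. x \<in> P \<Longrightarrow> (V has_derivative blinfun_apply (V' x)) (at x)"
    "\<And>x. x \<in> P \<Longrightarrow> v x = V x"
    using C1_on_continuous_differential[OF v_C1 convex_P interior_P] by metis
  have "continuous_on P V"
    using V(1) by (meson continuous_at_imp_continuous_on has_derivative_continuous)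
  then show ?thesis using V(2) by (simp cong: continuous_on_cong)
qed

lemma radial_density_cont: "continuous_on P radial_density"
proof -
  obtain V' :: "'a \<Rightarrow> ('a \<Rightarrow>\<^sub>L real)" where V: "continuous_on P V'"
    "\<And>x. x \<in> P \<Longrightarrow> differential_on P v x = blinfun_apply (V' x)"
    using C1_on_continuous_differential[OF v_C1 convex_P interior_P] by metis
  have "continuous_on P (\<lambda>x. (real DIM('a) + 1) * v x + blinfun_apply (V' x) (x - x\<^sub>0))"
    by (intro continuous_intros v_cont V)
  then show ?thesis using V(2) by (simp add: radial_density_def[abs_def] cong: continuous_on_cong)
qed

lemma defect_cont: "continuous_on P (defect j)"
  unfolding defect_def by (cases "L j x\<^sub>0 = 0") (auto intro!: continuous_intros radial_density_cont w_cont)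

lemma v_along_ray:
  assumes y: "y \<in> P"
  obtains V' where
    "\<And>t. t \<in> {0..1} \<Longrightarrow>
      ((\<lambda>t. v (x\<^sub>0 + t *\<^sub>R (y - x\<^sub>0))) has_real_derivative V' t) (at t within {0..1})"
    "continuous_on {0..1} V'"
    "\<And>t. t \<in> {0..1} \<Longrightarrow> radial_density (x\<^sub>0 + t *\<^sub>R (y - x\<^sub>0))
      = (DIM('a) + 1) * v (x\<^sub>0 + t *\<^sub>R (y - x\<^sub>0)) + t * V' t"
proof -
  obtain V and D :: "'a \<Rightarrow> ('a \<Rightarrow>\<^sub>L real)" where
    V: "\<And>x. x \<in> P \<Longrightarrow> (V has_derivative blinfun_apply (D x)) (at x)"
    "continuous_on P D" "\<And>x. x \<in> P \<Longrightarrow> v x = V x"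
    "\<And>x. x \<in> P \<Longrightarrow> differential_on P v x = blinfun_apply (D x)"
    using C1_on_continuous_differential[OF v_C1 convex_P interior_P] by metis
  let ?x = "\<lambda>t. x\<^sub>0 + t *\<^sub>R (y - x\<^sub>0)"
  have xP: "?x t \<in> P" if "t \<in> {0..1}" for t using ray_in_P[OF y] that by auto
  define V' where "V' t = blinfun_apply (D (?x t)) (y - x\<^sub>0)" for t
  show ?thesis
  proof (rule that)
    fix t :: real assume t: "t \<in> {0..1}"
    have "(?x has_derivative (\<lambda>s. s *\<^sub>R (y - x\<^sub>0))) (at t within {0..1})"
      by (auto intro!: derivative_eq_intros)
    from has_derivative_compose[OF this V(1)[OF xP[OF t]]]
    have "((\<lambda>t. V (?x t)) has_derivative (\<lambda>s. s * V' t)) (at t within {0..1})"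
      by (simp add: V'_def blinfun.scaleR_right)
    then have "((\<lambda>t. v (?x t)) has_derivative (\<lambda>s. s * V' t)) (at t within {0..1})"
      by (rule has_derivative_transform[OF t, rotated]) (use V(3) xP in auto)
    moreover have "(*) (V' t) = (\<lambda>s. s * V' t)" by (auto simp: fun_eq_iff)
    ultimately show "((\<lambda>t. v (?x t)) has_real_derivative V' t) (at t within {0..1})"
      by (simp only: has_field_derivative_def)
    show "radial_density (?x t) = (DIM('a) + 1) * v (?x t) + t * V' t"
      using V(4)[OF xP[OF t]] by (simp add: radial_density_def V'_def blinfun.scaleR_right)
  next
    show "continuous_on {0..1} V'"
      unfolding V'_def using xP
      by (intro continuous_intros continuous_on_compose2[OF V(2)]) auto
  qed
qed

text \<open>By definition \<open>w / 2 = E / L\<^sub>j(x\<^sub>0) - D\<^sub>j\<close>. The part with \<open>E\<close> is written in cone coordinates, where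
  it can be compared ray by ray with the boundary term \<open>g v\<close>.\<close>

lemma futaki_decomposition:
  assumes g: "continuous_on P g"
  shows "donaldson_futaki P d L v w g = 2 * (defect_integral g
    + (\<Sum>j\<in>{1..d}. LINT y:facet P L j|facet_measure j.
         g y * v y - ray_integral (\<lambda>x. g x * radial_density x) y))"
proof -
  have gv: "continuous_on P (\<lambda>x. g x * v x)" and gw: "continuous_on P (\<lambda>x. g x * w x)"
    and gE: "continuous_on P (\<lambda>x. g x * radial_density x)"
    by (intro continuous_intros g v_cont w_cont radial_density_cont)+
  have "(LINT x:cone j|lborel. defect j x * g x)
      + (LINT y:facet P L j|facet_measure j. g y * v y - ray_integral (\<lambda>x. g x * radial_density x) y)
      = (LINT y:facet P L j|facet_measure j. g y * v y) - (LINT x:cone j|lborel. g x * w x) / 2"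
    if j: "j \<in> {1..d}" for j
  proof -
    have a: "L j x\<^sub>0 > 0" by (rule L_x\<^sub>0[OF j])
    have "(LINT x:cone j|lborel. defect j x * g x)
        = (LINT x:cone j|lborel. g x * radial_density x / L j x\<^sub>0 - g x * w x / 2)"
      by (simp add: defect_def algebra_simps)
    also have "\<dots> = (LINT x:cone j|lborel. g x * radial_density x / L j x\<^sub>0)
        - (LINT x:cone j|lborel. g x * w x / 2)"
      using set_integrable_continuous[OF gE compact_cone[OF j] cone_subset]
        set_integrable_continuous[OF gw compact_cone[OF j] cone_subset]
      by (intro set_integral_diff(2) set_integrable_divide)
    also have "(LINT x:cone j|lborel. g x * radial_density x / L j x\<^sub>0)
        = (LINT y:facet P L j|facet_measure j. ray_integral (\<lambda>x. g x * radial_density x) y)"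
      using cone_integral[OF j gE] a by simp
    finally show ?thesis
      using set_integral_diff(2)[OF set_integrable_facet[OF j gv] set_integrable_ray_integral[OF j gE]] by simp
  qed
  then have "defect_integral g
    + (\<Sum>j\<in>{1..d}. LINT y:facet P L j|facet_measure j.
         g y * v y - ray_integral (\<lambda>x. g x * radial_density x) y)
    = (\<Sum>j\<in>{1..d}. (LINT y:facet P L j|facet_measure j. g y * v y)
        - (LINT x:cone j|lborel. g x * w x) / 2)"
    unfolding defect_integral_def by (simp add: sum.distrib[symmetric])
  also have "\<dots> = (LINT x:frontier P|labelled_boundary_measure P d L. g x * v x)
      - (LINT x:P|lborel. g x * w x) / 2"
    by (simp add: integral_boundary_eq_sum_facets[OF gv] integral_P_eq_sum_cones[OF gw]
        sum_subtractf sum_divide_distrib)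
  finally show ?thesis by (simp add: donaldson_futaki_def)
qed

text \<open>The failure of \<open>\<integral> t\<^bsup>n-1\<^esup> E dt = v(y)\<close> on the rays, summed over all of them: testing the invariant with
  the constant function \<open>1\<close> produces this number.\<close>

definition vertex_mass :: real where
  "vertex_mass = (\<Sum>j\<in>{1..d}. (LINT x:cone j|lborel. v x) / L j x\<^sub>0)"

lemma futaki_affine:
  assumes l: "affine_fun l"
  shows "donaldson_futaki P d L v w l = 2 * (defect_integral l - l x\<^sub>0 * vertex_mass)"
proof -
  have cl: "continuous_on P l" by (rule continuous_on_affine_fun[OF l])
  have ray: "l y * v y - ray_integral (\<lambda>x. l x * radial_density x) y = - (l x\<^sub>0 * ray_integral v y)"
    if yP: "y \<in> P" for y
  proof -
    obtain V' where V':
      "\<And>t. t \<in> {0..1} \<Longrightarrow>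
        ((\<lambda>t. v (x\<^sub>0 + t *\<^sub>R (y - x\<^sub>0))) has_real_derivative V' t) (at t within {0..1})"
      "continuous_on {0..1} V'"
      "\<And>t. t \<in> {0..1} \<Longrightarrow> radial_density (x\<^sub>0 + t *\<^sub>R (y - x\<^sub>0))
        = (DIM('a) + 1) * v (x\<^sub>0 + t *\<^sub>R (y - x\<^sub>0)) + t * V' t"
      using v_along_ray[OF yP] by metis
    have "ray_integral (\<lambda>x. l x * radial_density x) y
        = integral {0..1} (\<lambda>t. t ^ (DIM('a) - 1) * (((l y - l x\<^sub>0) * t + l x\<^sub>0)
            * ((DIM('a) + 1) * v (x\<^sub>0 + t *\<^sub>R (y - x\<^sub>0)) + t * V' t)))"
      unfolding ray_integral_def
    proof (intro Henstock_Kurzweil_Integration.integral_cong)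
      fix t :: real assume t: "t \<in> {0..1}"
      have "l (x\<^sub>0 + t *\<^sub>R (y - x\<^sub>0)) = (l y - l x\<^sub>0) * t + l x\<^sub>0"
        unfolding affine_fun_segment[OF l] by (simp add: algebra_simps)
      then show "t ^ (DIM('a) - 1) * (l (x\<^sub>0 + t *\<^sub>R (y - x\<^sub>0)) * radial_density (x\<^sub>0 + t *\<^sub>R (y - x\<^sub>0)))
        = t ^ (DIM('a) - 1) * (((l y - l x\<^sub>0) * t + l x\<^sub>0)
            * ((DIM('a) + 1) * v (x\<^sub>0 + t *\<^sub>R (y - x\<^sub>0)) + t * V' t))"
        by (simp only: V'(3)[OF t])
    qed
    also have "\<dots> = (l y - l x\<^sub>0 + l x\<^sub>0) * v (x\<^sub>0 + 1 *\<^sub>R (y - x\<^sub>0)) + l x\<^sub>0 * ray_integral v y"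
      unfolding ray_integral_def by (rule radial_integral_affine[OF DIM_positive V'(1,2)])
    finally show ?thesis by simp
  qed
  have "(LINT y:facet P L j|facet_measure j. l y * v y - ray_integral (\<lambda>x. l x * radial_density x) y)
      = - l x\<^sub>0 * ((LINT x:cone j|lborel. v x) / L j x\<^sub>0)" if j: "j \<in> {1..d}" for j
  proof -
    have "(LINT y:facet P L j|facet_measure j. l y * v y - ray_integral (\<lambda>x. l x * radial_density x) y)
        = (LINT y:facet P L j|facet_measure j. - l x\<^sub>0 * ray_integral v y)"
      using ray facet_subset compact_facet[OF j]
      by (intro set_lebesgue_integral_cong) (auto simp: borel_compact)
    also have "\<dots> = - l x\<^sub>0 * ((LINT x:cone j|lborel. v x) / L j x\<^sub>0)"
      using cone_integral[OF j v_cont] L_x\<^sub>0[OF j] by (subst set_integral_mult_right) simp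
    finally show ?thesis .
  qed
  then show ?thesis
    unfolding futaki_decomposition[OF cl] vertex_mass_def
    by (simp add: sum_distrib_left sum_negf)
qed

lemma v_lower_bound:
  obtains m where "m > 0" "\<And>x. x \<in> P \<Longrightarrow> m \<le> v x"
proof -
  obtain z where "z \<in> P" "\<And>x. x \<in> P \<Longrightarrow> v z \<le> v x"
    using continuous_attains_inf[OF compact_P _ v_cont] x\<^sub>0_P by blast
  then show ?thesis using v_pos that by blast
qed

lemma measure_P_pos: "0 < measure lborel P"
proof -
  obtain r where r: "r > 0" "ball x\<^sub>0 r \<subseteq> P" using x\<^sub>0 by (auto simp: mem_interior)
  have "0 < measure lborel (ball x\<^sub>0 r)" using content_ball_pos[OF r(1)] by simp
  also have "\<dots> \<le> measure lborel P"
    using r(2) compact_P emeasure_compact_finite[OF compact_P]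
    by (intro measure_mono_fmeasurable) (auto simp: fmeasurable_def borel_compact)
  finally show ?thesis .
qed

lemma vertex_mass_pos: "0 < vertex_mass"
proof -
  obtain m where m: "m > 0" "\<And>x. x \<in> P \<Longrightarrow> m \<le> v x" using v_lower_bound by blast
  have vj: "0 \<le> (LINT x:cone j|lborel. v x)" for j
    using v_pos cone_subset[of j] unfolding set_lebesgue_integral_def
    by (intro Bochner_Integration.integral_nonneg) (auto simp: indicator_def intro: less_imp_le)
  have "0 < m * measure lborel P" using m(1) measure_P_pos by simp
  also have "\<dots> = (LINT x:P|lborel. m)" by (simp add: set_lebesgue_integral_def)
  also have "\<dots> \<le> (LINT x:P|lborel. v x)"
    using m(2) by (intro set_integral_mono set_integrable_continuous[OF _ compact_P] v_cont continuous_on_const) auto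
  also have "\<dots> = (\<Sum>j\<in>{1..d}. LINT x:cone j|lborel. v x)" by (rule integral_P_eq_sum_cones[OF v_cont])
  finally obtain j where j: "j \<in> {1..d}" "(LINT x:cone j|lborel. v x) \<noteq> 0"
    by (metis less_irrefl sum.neutral)
  then have "0 < (LINT x:cone j|lborel. v x) / L j x\<^sub>0" using vj[of j] L_x\<^sub>0[OF j(1)] by simp
  then show ?thesis
    unfolding vertex_mass_def using j(1)
    by (intro sum_pos2[where i = j] divide_nonneg_pos vj L_x\<^sub>0) auto
qed

lemma futaki_add:
  assumes f: "continuous_on P f" and g: "continuous_on P g"
  shows "donaldson_futaki P d L v w (\<lambda>x. f x + g x)
    = donaldson_futaki P d L v w f + donaldson_futaki P d L v w g"
proof -
  have *: "(LINT x:P|lborel. (f x + g x) * w x)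
      = (LINT x:P|lborel. f x * w x) + (LINT x:P|lborel. g x * w x)"
    unfolding distrib_right
    by (intro set_integral_add(2) set_integrable_continuous compact_P order_refl continuous_intros f g w_cont)
  have "continuous_on P (\<lambda>x. f x * v x)" "continuous_on P (\<lambda>x. g x * v x)"
    "continuous_on P (\<lambda>x. f x * v x + g x * v x)"
    by (intro continuous_intros f g v_cont)+
  then have "(LINT x:frontier P|labelled_boundary_measure P d L. (f x + g x) * v x)
      = (LINT x:frontier P|labelled_boundary_measure P d L. f x * v x)
        + (LINT x:frontier P|labelled_boundary_measure P d L. g x * v x)"
    unfolding distrib_right
    by (simp add: integral_boundary_eq_sum_facets set_integrable_facet sum.distrib)
  with * show ?thesis by (simp add: donaldson_futaki_def)
qed

end

section \<open>The defect of the inequality near the vertex\<close>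

locale futaki_polytope = weighted_polytope +
  assumes futaki_vanishes: "\<And>l. affine_fun l \<Longrightarrow> donaldson_futaki P d L v w l = 0"
    and defect_nonneg: "\<And>j x. j \<in> {1..d} \<Longrightarrow> x \<in> cone j \<Longrightarrow> 0 \<le> defect j x"
begin

lemma defect_integral_affine: "affine_fun l \<Longrightarrow> defect_integral l = l x\<^sub>0 * vertex_mass"
  using futaki_affine[of l] futaki_vanishes[of l] by simp

lemma AE_cone_interior: "AE x in lborel. x \<in> cone j \<longrightarrow> x \<in> interior (cone j)"
proof -
  have "negligible (frontier (cone j))" by (rule negligible_convex_frontier[OF convex_cone])
  then have "frontier (cone j) \<in> null_sets lborel"
    by (simp add: negligible_iff_null_sets null_sets_completion_iff frontier_closed)
  from AE_not_in[OF this] show ?thesis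
    by eventually_elim (auto simp: frontier_def intro: closure_subset[THEN subsetD])
qed

definition defect_support :: "'a set" where
  "defect_support = (\<Union>j\<in>{1..d}. {x \<in> interior (cone j). 0 < defect j x})"

lemma open_defect_support: "open defect_support"
  unfolding defect_support_def
proof (intro open_UN ballI)
  fix j
  have "continuous_on (interior (cone j)) (defect j)"
    using continuous_on_subset[OF defect_cont] cone_subset interior_subset by (meson subset_trans)
  then have "open (interior (cone j) \<inter> defect j -` {0<..})"
    by (intro continuous_open_preimage) auto
  moreover have "interior (cone j) \<inter> defect j -` {0<..} = {x \<in> interior (cone j). 0 < defect j x}" by auto
  ultimately show "open {x \<in> interior (cone j). 0 < defect j x}" by simp
qed

lemma set_integrable_defect:
  fixes g :: "'a \<Rightarrow> real"
  assumes "continuous_on P g" "j \<in> {1..d}"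
  shows "set_integrable lborel (cone j) (\<lambda>x. defect j x * g x)"
  by (intro set_integrable_continuous compact_cone cone_subset continuous_intros defect_cont assms)

text \<open>Otherwise some nonzero linear functional \<open>h\<close> vanishing at \<open>x\<^sub>0\<close> is nonnegative on the support. Its
  defect integral is zero, so \<open>D\<^sub>j h\<close>, and with it \<open>D\<^sub>j\<close>, vanishes almost everywhere. This contradicts
  the positive defect integral of the constant \<open>1\<close>.\<close>

lemma x\<^sub>0_in_hull_defect_support: "x\<^sub>0 \<in> convex hull defect_support"
proof (rule ccontr)
  assume "x\<^sub>0 \<notin> convex hull defect_support"
  then have "0 \<notin> (\<lambda>x. - x\<^sub>0 + x) ` (convex hull defect_support)" by (auto simp: image_iff)
  then obtain a where a: "a \<noteq> 0" "\<And>x. x \<in> defect_support \<Longrightarrow> 0 \<le> a \<bullet> (x - x\<^sub>0)"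
    using separating_hyperplane_set_0[OF convex_translation[OF convex_convex_hull, of "- x\<^sub>0" defect_support]]
    by (auto simp: hull_inc)
  define h where "h x = a \<bullet> (x - x\<^sub>0)" for x
  have h: "affine_fun h"
    unfolding affine_fun_def h_def by (auto intro!: linearI simp: inner_diff_right inner_add_right)
  have hc: "continuous_on P h" unfolding h_def by (intro continuous_intros)
  have nonneg: "AE x in lborel. 0 \<le> indicator (cone j) x *\<^sub>R (defect j x * h x)" if j: "j \<in> {1..d}" for j
    using AE_cone_interior[of j]
  proof eventually_elim
    case (elim x)
    show ?case
    proof (cases "x \<in> cone j \<and> 0 < defect j x")
      case True
      then have "x \<in> defect_support" using elim j by (auto simp: defect_support_def)
      then have "0 \<le> h x" using a(2) by (simp add: h_def)
      then show ?thesis using True by simp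
    next
      case False
      then have "x \<in> cone j \<Longrightarrow> defect j x = 0" using defect_nonneg[OF j, of x] by force
      then show ?thesis by (cases "x \<in> cone j") auto
    qed
  qed
  have "(\<Sum>j\<in>{1..d}. LINT x:cone j|lborel. defect j x * h x) = 0"
    using defect_integral_affine[OF h] by (simp add: defect_integral_def h_def)
  then have zero: "(LINT x:cone j|lborel. defect j x * h x) = 0" if j: "j \<in> {1..d}" for j
    using j nonneg
    by (subst (asm) sum_nonneg_eq_0_iff) (auto simp: set_lebesgue_integral_def intro!: integral_nonneg_AE)
  have "{x. a \<bullet> x = a \<bullet> x\<^sub>0} \<in> null_sets lborel"
    using negligible_hyperplane[of a "a \<bullet> x\<^sub>0"] a(1)
    by (simp add: negligible_iff_null_sets null_sets_completion_iff closed_hyperplane)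
  from AE_not_in[OF this] have h0: "AE x in lborel. h x \<noteq> 0"
    by eventually_elim (auto simp: h_def inner_diff_right)
  have "(LINT x:cone j|lborel. defect j x * 1) = 0" if j: "j \<in> {1..d}" for j
  proof -
    have "AE x in lborel. indicator (cone j) x *\<^sub>R (defect j x * h x) = 0"
      using integral_nonneg_eq_0_iff_AE[OF _ nonneg[OF j]] set_integrable_defect[OF hc j] zero[OF j]
      by (simp add: set_integrable_def set_lebesgue_integral_def)
    then have "AE x in lborel. indicator (cone j) x *\<^sub>R (defect j x * 1) = 0"
      using h0 by eventually_elim auto
    then show ?thesis unfolding set_lebesgue_integral_def by (rule integral_eq_zero_AE)
  qed
  then have "defect_integral (\<lambda>_. 1) = 0" by (simp add: defect_integral_def)
  moreover have "affine_fun (\<lambda>_::'a. 1)" by (simp add: affine_fun_def linear_zero)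
  ultimately show False using defect_integral_affine[of "\<lambda>_. 1"] vertex_mass_pos by simp
qed

lemma defect_integral_nonneg:
  assumes "\<And>x. x \<in> P \<Longrightarrow> 0 \<le> g x"
  shows "0 \<le> defect_integral g"
  unfolding defect_integral_def set_lebesgue_integral_def
  using assms defect_nonneg cone_subset
  by (intro sum_nonneg Bochner_Integration.integral_nonneg) (auto simp: indicator_def subset_iff)

text \<open>On a small ball around \<open>c\<close> the defect is bounded below by a positive constant, and the integral
  of \<open>g\<close> over the ball dominates \<open>g(c)\<close>.\<close>

lemma defect_integral_ge_point:
  assumes "c \<in> defect_support"
  obtains \<kappa> where "\<kappa> > 0"
    "\<And>g. continuous_on P g \<Longrightarrow> convex_on P g \<Longrightarrow> (\<And>x. x \<in> P \<Longrightarrow> 0 \<le> g x) \<Longrightarrow> \<kappa> * g c \<le> defect_integral g"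
proof -
  obtain j where j: "j \<in> {1..d}" "c \<in> interior (cone j)" "0 < defect j c"
    using assms by (auto simp: defect_support_def)
  have "continuous_on (interior (cone j)) (defect j)"
    using continuous_on_subset[OF defect_cont] cone_subset interior_subset by (meson subset_trans)
  then have "open (interior (cone j) \<inter> defect j -` {defect j c / 2<..})"
    by (intro continuous_open_preimage) auto
  then obtain r where r: "r > 0" "cball c r \<subseteq> interior (cone j) \<inter> defect j -` {defect j c / 2<..}"
    using j(2,3) unfolding open_contains_cball by (metis IntI field_sum_of_halves greaterThan_iff less_add_same_cancel1 half_gt_zero vimageI)
  define \<delta> where "\<delta> = defect j c / 2"
  have B: "cball c r \<subseteq> cone j" "\<And>x. x \<in> cball c r \<Longrightarrow> \<delta> \<le> defect j x"
    using r(2) interior_subset by (auto simp: \<delta>_def less_imp_le)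
  have \<delta>: "\<delta> > 0" using j(3) by (simp add: \<delta>_def)
  show ?thesis
  proof (rule that)
    show "0 < \<delta> * measure lborel (cball c r)" using \<delta> content_cball_pos[OF r(1), of c] by simp
    fix g :: "'a \<Rightarrow> real"
    assume g: "continuous_on P g" "convex_on P g" "\<And>x. x \<in> P \<Longrightarrow> 0 \<le> g x"
    have BP: "cball c r \<subseteq> P" using B(1) cone_subset by blast
    have "\<delta> * measure lborel (cball c r) * g c \<le> \<delta> * (LINT x:cball c r|lborel. g x)"
      using \<delta> set_integral_cball_ge_centre[OF convex_on_subset[OF g(2) BP] continuous_on_subset[OF g(1) BP]]
      by (simp add: mult.assoc)
    also have "\<dots> = (LINT x:cball c r|lborel. \<delta> * g x)" by simp
    also have "\<dots> \<le> (LINT x:cone j|lborel. defect j x * g x)"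
      unfolding set_lebesgue_integral_def
    proof (rule integral_mono)
      show "integrable lborel (\<lambda>x. indicator (cball c r) x *\<^sub>R (\<delta> * g x))"
        by (intro borel_integrable_compact compact_cball continuous_intros continuous_on_subset[OF g(1) BP])
      show "integrable lborel (\<lambda>x. indicator (cone j) x *\<^sub>R (defect j x * g x))"
        using set_integrable_defect[OF g(1) j(1)] by (simp add: set_integrable_def)
      fix x
      show "indicator (cball c r) x *\<^sub>R (\<delta> * g x) \<le> indicator (cone j) x *\<^sub>R (defect j x * g x)"
        using B g(3)[of x] cone_subset[of j] defect_nonneg[OF j(1), of x]
        by (auto simp: indicator_def intro: mult_right_mono)
    qed
    also have "\<dots> \<le> defect_integral g"
      unfolding defect_integral_def using j(1) defect_nonneg g(3) cone_subset
      by (intro member_le_sum)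
         (auto simp: set_lebesgue_integral_def indicator_def subset_iff intro!: Bochner_Integration.integral_nonneg)
    finally show "\<delta> * measure lborel (cball c r) * g c \<le> defect_integral g" .
  qed
qed

text \<open>On the convex hull of finitely many points a convex function is bounded by its largest value at
  these points.\<close>

lemma defect_integral_ge_neighbourhood:
  obtains \<kappa> r where "\<kappa> > 0" "r > 0"
    "\<And>g z. continuous_on P g \<Longrightarrow> convex_on P g \<Longrightarrow> (\<And>x. x \<in> P \<Longrightarrow> 0 \<le> g x) \<Longrightarrow> z \<in> cball x\<^sub>0 r
      \<Longrightarrow> \<kappa> * g z \<le> defect_integral g"
proof -
  obtain T r where T: "finite T" "T \<subseteq> defect_support" "r > 0" "cball x\<^sub>0 r \<subseteq> convex hull T"
    using finite_hull_neighbourhood[OF open_defect_support x\<^sub>0_in_hull_defect_support] by metis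
  have "\<exists>\<kappa>>0. \<forall>g. continuous_on P g \<longrightarrow> convex_on P g \<longrightarrow> (\<forall>x\<in>P. 0 \<le> g x) \<longrightarrow> \<kappa> * g c \<le> defect_integral g"
    if "c \<in> T" for c
    using defect_integral_ge_point[of c] that T(2) by (metis subsetD)
  then obtain k where k: "\<And>c. c \<in> T \<Longrightarrow> k c > 0"
    "\<And>c g. c \<in> T \<Longrightarrow> continuous_on P g \<Longrightarrow> convex_on P g \<Longrightarrow> (\<And>x. x \<in> P \<Longrightarrow> 0 \<le> g x) \<Longrightarrow> k c * g c \<le> defect_integral g"
    by metis
  have "T \<noteq> {}" using T(3,4) by auto
  define \<kappa> where "\<kappa> = Min (k ` T)"
  have \<kappa>: "\<kappa> > 0" "\<And>c. c \<in> T \<Longrightarrow> \<kappa> \<le> k c" using T(1) \<open>T \<noteq> {}\<close> k(1) by (auto simp: \<kappa>_def)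
  have TP: "T \<subseteq> P" using T(2) cone_subset interior_subset by (fastforce simp: defect_support_def)
  show ?thesis
  proof (rule that[OF \<kappa>(1) T(3)])
    fix g :: "'a \<Rightarrow> real" and z
    assume g: "continuous_on P g" "convex_on P g" "\<And>x. x \<in> P \<Longrightarrow> 0 \<le> g x" and z: "z \<in> cball x\<^sub>0 r"
    have "g c \<le> defect_integral g / \<kappa>" if "c \<in> T" for c
    proof -
      have "\<kappa> * g c \<le> k c * g c" using \<kappa>(2) that g(3) TP by (intro mult_right_mono) auto
      also have "\<dots> \<le> defect_integral g" using k(2)[OF that] g by blast
      finally show ?thesis using \<kappa>(1) by (simp add: field_simps)
    qed
    moreover have "convex hull T \<subseteq> P" using TP convex_P by (rule hull_minimal)
    ultimately have "g z \<le> defect_integral g / \<kappa>"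
      using convex_on_convex_hull_bound[OF convex_on_subset[OF g(2)]] T(4) z by blast
    then show "\<kappa> * g z \<le> defect_integral g" using \<kappa>(1) by (simp add: field_simps)
  qed
qed

section \<open>Uniform stability\<close>

definition convexity_gap :: "('a \<Rightarrow> real) \<Rightarrow> 'a \<Rightarrow> real" where
  "convexity_gap g y = g y - real (DIM('a) + 1) * ray_integral g y"

definition total_convexity_gap :: "('a \<Rightarrow> real) \<Rightarrow> real" where
  "total_convexity_gap g = (\<Sum>j\<in>{1..d}. LINT y:facet P L j|facet_measure j. convexity_gap g y)"

definition normalised_convex :: "('a \<Rightarrow> real) \<Rightarrow> bool" where
  "normalised_convex g \<longleftrightarrow> continuous_on P g \<and> convex_on P g \<and> g x\<^sub>0 = 0 \<and> (\<forall>x\<in>P. 0 \<le> g x)"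

lemma set_integrable_convexity_gap:
  assumes "normalised_convex g" "j \<in> {1..d}"
  shows "set_integrable (facet_measure j) (facet P L j) (convexity_gap g)"
  using assms unfolding convexity_gap_def normalised_convex_def
  by (intro set_integral_diff(1) set_integrable_mult_right set_integrable_facet set_integrable_ray_integral) auto

lemma convexity_gap_ge:
  assumes g: "normalised_convex g" and y: "y \<in> P" and \<epsilon>: "0 < \<epsilon>" "\<epsilon> \<le> 1"
  shows "\<epsilon> ^ (DIM('a) + 1) * (g y - g (x\<^sub>0 + \<epsilon> *\<^sub>R (y - x\<^sub>0)) / \<epsilon>) \<le> convexity_gap g y"
proof -
  let ?\<phi> = "\<lambda>t. g (x\<^sub>0 + t *\<^sub>R (y - x\<^sub>0))"
  have "\<epsilon> ^ (DIM('a) + 1) * (?\<phi> 1 - ?\<phi> \<epsilon> / \<epsilon>)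
      \<le> ?\<phi> 1 - real (DIM('a) + 1) * integral {0..1} (\<lambda>t. t ^ (DIM('a) - 1) * ?\<phi> t)"
    using g y ray_in_P[OF y]
    by (intro radial_convexity_gap[OF DIM_positive] convex_along_ray ray_cont \<epsilon>)
       (auto simp: normalised_convex_def)
  then show ?thesis by (simp add: convexity_gap_def ray_integral_def)
qed

lemma convexity_gap_nonneg: "normalised_convex g \<Longrightarrow> y \<in> P \<Longrightarrow> 0 \<le> convexity_gap g y"
  using convexity_gap_ge[of g y 1] by simp

text \<open>In the decomposition of the invariant, the boundary term minus the radial term is at least \<open>m\<close> times
  the convexity gap on every ray, by the one-variable inequality.\<close>

lemma futaki_lower_bound:
  assumes g: "normalised_convex g" and m: "\<And>x. x \<in> P \<Longrightarrow> m \<le> v x"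
  shows "2 * (defect_integral g + m * total_convexity_gap g) \<le> donaldson_futaki P d L v w g"
proof -
  have gc: "continuous_on P g" using g by (simp add: normalised_convex_def)
  have ray: "m * convexity_gap g y \<le> g y * v y - ray_integral (\<lambda>x. g x * radial_density x) y"
    if y: "y \<in> P" for y
  proof -
    obtain V' where V':
      "\<And>t. t \<in> {0..1} \<Longrightarrow>
        ((\<lambda>t. v (x\<^sub>0 + t *\<^sub>R (y - x\<^sub>0))) has_real_derivative V' t) (at t within {0..1})"
      "continuous_on {0..1} V'"
      "\<And>t. t \<in> {0..1} \<Longrightarrow> radial_density (x\<^sub>0 + t *\<^sub>R (y - x\<^sub>0))
        = (DIM('a) + 1) * v (x\<^sub>0 + t *\<^sub>R (y - x\<^sub>0)) + t * V' t"
      using v_along_ray[OF y] by metis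
    have "ray_integral (\<lambda>x. g x * radial_density x) y
        = integral {0..1} (\<lambda>t. t ^ (DIM('a) - 1) * (g (x\<^sub>0 + t *\<^sub>R (y - x\<^sub>0))
            * ((DIM('a) + 1) * v (x\<^sub>0 + t *\<^sub>R (y - x\<^sub>0)) + t * V' t)))"
      unfolding ray_integral_def
      by (intro Henstock_Kurzweil_Integration.integral_cong) (simp only: V'(3))
    moreover have "integral {0..1} (\<lambda>t. t ^ (DIM('a) - 1) * (g (x\<^sub>0 + t *\<^sub>R (y - x\<^sub>0))
            * ((DIM('a) + 1) * v (x\<^sub>0 + t *\<^sub>R (y - x\<^sub>0)) + t * V' t)))
        + m * (g (x\<^sub>0 + 1 *\<^sub>R (y - x\<^sub>0)) - (DIM('a) + 1) *
            integral {0..1} (\<lambda>t. t ^ (DIM('a) - 1) * g (x\<^sub>0 + t *\<^sub>R (y - x\<^sub>0))))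
        \<le> g (x\<^sub>0 + 1 *\<^sub>R (y - x\<^sub>0)) * v (x\<^sub>0 + 1 *\<^sub>R (y - x\<^sub>0))"
      using g y m ray_in_P[OF y]
      by (intro radial_integral_le[OF DIM_positive] V' convex_along_ray ray_cont)
         (auto simp: normalised_convex_def)
    ultimately show ?thesis by (simp add: convexity_gap_def ray_integral_def)
  qed
  have gE: "continuous_on P (\<lambda>x. g x * radial_density x)" and gv: "continuous_on P (\<lambda>x. g x * v x)"
    by (intro continuous_intros gc radial_density_cont v_cont)+
  have "m * total_convexity_gap g
      = (\<Sum>j\<in>{1..d}. LINT y:facet P L j|facet_measure j. m * convexity_gap g y)"
    by (simp add: total_convexity_gap_def sum_distrib_left)
  also have "\<dots> \<le> (\<Sum>j\<in>{1..d}. LINT y:facet P L j|facet_measure j.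
      g y * v y - ray_integral (\<lambda>x. g x * radial_density x) y)"
    using ray facet_subset
    by (intro sum_mono set_integral_mono set_integral_diff(1) set_integrable_mult_right
        set_integrable_convexity_gap g set_integrable_facet gv set_integrable_ray_integral gE) auto
  finally show ?thesis by (simp add: futaki_decomposition[OF gc])
qed

text \<open>On every ray, \<open>g(y)\<close> is at most \<open>g(x\<^sub>0 + \<epsilon> (y - x\<^sub>0)) / \<epsilon>\<close> plus a multiple of the convexity gap. For
  small \<open>\<epsilon>\<close> all the points \<open>x\<^sub>0 + \<epsilon> (y - x\<^sub>0)\<close> lie in the neighbourhood of \<open>x\<^sub>0\<close> where \<open>g\<close> is controlled by
  its defect integral.\<close>

lemma integral_le_defect_plus_gap:
  obtains A B where "A \<ge> 0" "B \<ge> 0"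
    "\<And>g. normalised_convex g \<Longrightarrow>
      (LINT x:P|lborel. g x) \<le> A * defect_integral g + B * total_convexity_gap g"
proof -
  obtain \<kappa> r where \<kappa>: "\<kappa> > 0" "r > 0"
    "\<And>g z. continuous_on P g \<Longrightarrow> convex_on P g \<Longrightarrow> (\<And>x. x \<in> P \<Longrightarrow> 0 \<le> g x) \<Longrightarrow> z \<in> cball x\<^sub>0 r
      \<Longrightarrow> \<kappa> * g z \<le> defect_integral g"
    using defect_integral_ge_neighbourhood by metis
  obtain R where R: "R > 0" "\<And>y. y \<in> P \<Longrightarrow> norm (y - x\<^sub>0) \<le> R"
    using bounded_P unfolding bounded_any_center[where a = x\<^sub>0]
    by (metis dist_norm dist_commute linorder_not_le max.cobounded1 max.cobounded2 order.trans zero_less_one less_le_trans)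
  \<comment> \<open>The homothety of ratio \<open>\<epsilon>\<close> moves \<open>P\<close> into the ball of radius \<open>r\<close>.\<close>
  define \<epsilon> where "\<epsilon> = min 1 (r / R)"
  have \<epsilon>: "0 < \<epsilon>" "\<epsilon> \<le> 1" "\<epsilon> * R \<le> r"
    using \<kappa>(2) R(1) by (auto simp: \<epsilon>_def min_def field_simps)
  define s where "s j = measure (facet_measure j) (facet P L j)" for j
  define A where "A = (\<Sum>j\<in>{1..d}. L j x\<^sub>0 * s j) / (\<kappa> * \<epsilon>)"
  define B where "B = (\<Sum>j\<in>{1..d}. L j x\<^sub>0) / \<epsilon> ^ (DIM('a) + 1)"
  show ?thesis
  proof (rule that)
    show "A \<ge> 0" "B \<ge> 0"
      unfolding A_def B_def s_def using \<kappa>(1) \<epsilon>(1) L_x\<^sub>0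
      by (auto intro!: divide_nonneg_nonneg sum_nonneg mult_nonneg_nonneg simp: less_imp_le)
    fix g assume g: "normalised_convex g"
    then have gc: "continuous_on P g" and gx: "convex_on P g" and g0: "\<And>x. x \<in> P \<Longrightarrow> 0 \<le> g x"
      by (auto simp: normalised_convex_def)
    let ?D = "defect_integral g" and ?n = "DIM('a)"
    have ray: "ray_integral g y \<le> ?D / (\<kappa> * \<epsilon>) + convexity_gap g y / \<epsilon> ^ (?n + 1)" if y: "y \<in> P" for y
    proof -
      have "norm (\<epsilon> *\<^sub>R (y - x\<^sub>0)) \<le> \<epsilon> * R" using R(2)[OF y] \<epsilon>(1) by simp
      then have "x\<^sub>0 + \<epsilon> *\<^sub>R (y - x\<^sub>0) \<in> cball x\<^sub>0 r" using \<epsilon>(3) by (simp add: dist_norm)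
      then have "\<kappa> * g (x\<^sub>0 + \<epsilon> *\<^sub>R (y - x\<^sub>0)) \<le> ?D" by (intro \<kappa>(3) gc gx g0)
      then have 1: "g (x\<^sub>0 + \<epsilon> *\<^sub>R (y - x\<^sub>0)) / \<epsilon> \<le> ?D / (\<kappa> * \<epsilon>)"
        using \<kappa>(1) \<epsilon>(1) by (simp add: field_simps)
      have "g y - g (x\<^sub>0 + \<epsilon> *\<^sub>R (y - x\<^sub>0)) / \<epsilon> \<le> convexity_gap g y / \<epsilon> ^ (?n + 1)"
        using convexity_gap_ge[OF g y \<epsilon>(1,2)] \<epsilon>(1) by (subst pos_le_divide_eq) (auto simp: mult.commute)
      with 1 have 2: "g y \<le> ?D / (\<kappa> * \<epsilon>) + convexity_gap g y / \<epsilon> ^ (?n + 1)" by simp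
      have "real (?n + 1) * ray_integral g y \<le> g y"
        using convexity_gap_nonneg[OF g y] by (simp add: convexity_gap_def)
      moreover have "0 \<le> ray_integral g y"
        unfolding ray_integral_def using g0 ray_in_P[OF y]
        by (intro Henstock_Kurzweil_Integration.integral_nonneg integrable_continuous_real continuous_intros ray_cont gc y) auto
      then have "1 * ray_integral g y \<le> real (?n + 1) * ray_integral g y" by (intro mult_right_mono) auto
      ultimately show ?thesis using 2 by simp
    qed
    have facet_le: "(LINT x:cone j|lborel. g x)
        \<le> L j x\<^sub>0 * s j * (?D / (\<kappa> * \<epsilon>))
          + B * (LINT y:facet P L j|facet_measure j. convexity_gap g y)" if j: "j \<in> {1..d}" for j
    proof -
      have a: "L j x\<^sub>0 > 0" by (rule L_x\<^sub>0[OF j])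
      note gap = set_integrable_convexity_gap[OF g j]
      have const: "set_integrable (facet_measure j) (facet P L j) (\<lambda>_. ?D / (\<kappa> * \<epsilon>))"
        by (intro set_integrable_facet j continuous_on_const)
      have gap0: "0 \<le> (LINT y:facet P L j|facet_measure j. convexity_gap g y)"
        unfolding set_lebesgue_integral_def using convexity_gap_nonneg[OF g] facet_subset
        by (intro Bochner_Integration.integral_nonneg) (auto simp: indicator_def)
      have "(LINT y:facet P L j|facet_measure j. ray_integral g y)
          \<le> (LINT y:facet P L j|facet_measure j. ?D / (\<kappa> * \<epsilon>) + convexity_gap g y / \<epsilon> ^ (?n + 1))"
        using ray facet_subset
        by (intro set_integral_mono set_integrable_ray_integral j gc set_integral_add(1) const set_integrable_divide gap) auto
      also have "\<dots> = (LINT y:facet P L j|facet_measure j. ?D / (\<kappa> * \<epsilon>))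
          + (LINT y:facet P L j|facet_measure j. convexity_gap g y / \<epsilon> ^ (?n + 1))"
        by (intro set_integral_add(2) const set_integrable_divide gap)
      also have "(LINT y:facet P L j|facet_measure j. ?D / (\<kappa> * \<epsilon>)) = s j * (?D / (\<kappa> * \<epsilon>))"
        unfolding s_def set_lebesgue_integral_def
        using facet_measure_finite[OF j] borel_compact[OF compact_facet[OF j]] by simp
      finally have "(LINT x:cone j|lborel. g x) \<le> L j x\<^sub>0 *
          (s j * (?D / (\<kappa> * \<epsilon>)) + (LINT y:facet P L j|facet_measure j. convexity_gap g y) / \<epsilon> ^ (?n + 1))"
        unfolding cone_integral[OF j gc] using a by simp
      also have "\<dots> = L j x\<^sub>0 * s j * (?D / (\<kappa> * \<epsilon>))
          + L j x\<^sub>0 / \<epsilon> ^ (?n + 1) * (LINT y:facet P L j|facet_measure j. convexity_gap g y)"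
        by (simp add: distrib_left mult.assoc)
      also have "\<dots> \<le> L j x\<^sub>0 * s j * (?D / (\<kappa> * \<epsilon>))
          + B * (LINT y:facet P L j|facet_measure j. convexity_gap g y)"
        unfolding B_def using gap0 \<epsilon>(1) L_x\<^sub>0 j
        by (intro add_left_mono mult_right_mono divide_right_mono member_le_sum) (auto simp: less_imp_le)
      finally show ?thesis .
    qed
    have "(LINT x:P|lborel. g x) = (\<Sum>j\<in>{1..d}. LINT x:cone j|lborel. g x)"
      by (rule integral_P_eq_sum_cones[OF gc])
    also have "\<dots> \<le> (\<Sum>j\<in>{1..d}. L j x\<^sub>0 * s j * (?D / (\<kappa> * \<epsilon>))
          + B * (LINT y:facet P L j|facet_measure j. convexity_gap g y))"
      by (intro sum_mono facet_le)
    also have "\<dots> = A * ?D + B * total_convexity_gap g"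
      by (simp add: sum.distrib A_def total_convexity_gap_def sum_distrib_left sum_distrib_right sum_divide_distrib)
    finally show "(LINT x:P|lborel. g x) \<le> A * ?D + B * total_convexity_gap g" .
  qed
qed

lemma J_norm_le:
  assumes f: "continuous_on P f" and l: "affine_fun l"
    and g: "\<And>x. x \<in> P \<Longrightarrow> 0 \<le> f x + l x" "f x\<^sub>0 + l x\<^sub>0 = 0"
  shows "J_norm P f \<le> (LINT x:P|lborel. f x + l x)"
proof -
  have inf: "(INF y\<in>P. f y + l y) = 0"
    using g x\<^sub>0_P by (intro cInf_eq_minimum) (auto simp: image_iff intro!: bexI[of _ x\<^sub>0])
  have "0 \<le> (LINT x:P|lborel. f x + k x - (INF y\<in>P. f y + k y))" if k: "affine_fun k" for k
  proof -
    have "continuous_on P k" by (rule continuous_on_affine_fun[OF k])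
    then have "compact ((\<lambda>y. f y + k y) ` P)"
      by (intro compact_continuous_image continuous_intros f compact_P)
    then have "bdd_below ((\<lambda>y. f y + k y) ` P)" by (intro bounded_imp_bdd_below compact_imp_bounded)
    then have "(INF y\<in>P. f y + k y) \<le> f x + k x" if "x \<in> P" for x using that by (rule cINF_lower)
    then show ?thesis
      unfolding set_lebesgue_integral_def
      by (intro Bochner_Integration.integral_nonneg) (auto simp: indicator_def)
  qed
  then have "J_norm P f \<le> (LINT x:P|lborel. f x + l x - (INF y\<in>P. f y + l y))"
    unfolding J_norm_def using l by (intro cINF_lower bdd_belowI2[where m = 0]) auto
  then show ?thesis by (simp add: inf)
qed

lemma uniformly_K_stable: "uniformly_K_stable P d L v w"
proof -
  obtain m where m: "m > 0" "\<And>x. x \<in> P \<Longrightarrow> m \<le> v x" using v_lower_bound by blast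
  obtain A B where AB: "A \<ge> 0" "B \<ge> 0"
    "\<And>g. normalised_convex g \<Longrightarrow>
      (LINT x:P|lborel. g x) \<le> A * defect_integral g + B * total_convexity_gap g"
    using integral_le_defect_plus_gap by metis
  \<comment> \<open>Chosen such that \<open>c A \<le> 2\<close> and \<open>c B \<le> 2 m\<close>, the coefficients in the lower bound for the invariant.\<close>
  define c where "c = 2 / (A + B / m + 1)"
  have den: "A + B / m + 1 > 0" using AB m(1) by (simp add: add_nonneg_pos)
  have c: "c > 0" using den by (simp add: c_def)
  have cA: "c * A \<le> 2" and cB: "c * B \<le> 2 * m"
  proof -
    have "c * (A + B / m + 1) = 2" using den by (metis c_def less_irrefl nonzero_eq_divide_eq)
    moreover have "0 \<le> c * A" "0 \<le> c * (B / m)" using c AB m(1) by auto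
    ultimately have "c * A \<le> 2" "c * (B / m) \<le> 2" using c by (simp_all only: distrib_left)
    then show "c * A \<le> 2" "c * B \<le> 2 * m" using m(1) by (simp_all add: field_simps)
  qed
  have "c * J_norm P f \<le> donaldson_futaki P d L v w f" if f: "continuous_on P f" "convex_on P f" for f
  proof -
    obtain a where a: "\<And>x. x \<in> P \<Longrightarrow> f x\<^sub>0 + a \<bullet> (x - x\<^sub>0) \<le> f x"
      using convex_on_supporting_affine[OF f(2) x\<^sub>0] by blast
    define l where "l x = - (f x\<^sub>0 + a \<bullet> (x - x\<^sub>0))" for x
    define g where "g x = f x + l x" for x
    have l: "affine_fun l"
      unfolding affine_fun_def l_def by (auto intro!: linearI simp: inner_diff_right inner_add_right)
    have lc: "continuous_on P l" by (rule continuous_on_affine_fun[OF l])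
    have "convex_on P l"
      unfolding l_def by (intro convex_onI convex_P) (simp add: algebra_simps)
    then have "convex_on P g" unfolding g_def by (intro convex_on_add f)
    moreover have "continuous_on P g" unfolding g_def by (intro continuous_intros f lc)
    moreover have g0: "0 \<le> g x" if "x \<in> P" for x using a[OF that] by (simp add: g_def l_def)
    moreover have "g x\<^sub>0 = 0" by (simp add: g_def l_def)
    ultimately have g: "normalised_convex g" by (simp add: normalised_convex_def)
    have D: "0 \<le> defect_integral g" using g by (intro defect_integral_nonneg) (auto simp: normalised_convex_def)
    have G: "0 \<le> total_convexity_gap g"
      unfolding total_convexity_gap_def set_lebesgue_integral_def
      using convexity_gap_nonneg[OF g] facet_subset
      by (intro sum_nonneg Bochner_Integration.integral_nonneg) (auto simp: indicator_def)
    have "J_norm P f \<le> (LINT x:P|lborel. g x)"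
      unfolding g_def
    proof (rule J_norm_le[OF f(1) l])
      show "0 \<le> f x + l x" if "x \<in> P" for x using g0[OF that] by (simp add: g_def)
      show "f x\<^sub>0 + l x\<^sub>0 = 0" by (simp add: l_def)
    qed
    then have "J_norm P f \<le> A * defect_integral g + B * total_convexity_gap g" using AB(3)[OF g] by simp
    then have "c * J_norm P f \<le> c * (A * defect_integral g + B * total_convexity_gap g)"
      using c by simp
    also have "\<dots> = (c * A) * defect_integral g + (c * B) * total_convexity_gap g" by (simp add: algebra_simps)
    also have "\<dots> \<le> 2 * defect_integral g + (2 * m) * total_convexity_gap g"
      by (intro add_mono mult_right_mono cA cB D G)
    also have "\<dots> \<le> donaldson_futaki P d L v w g" using futaki_lower_bound[OF g m(2)] by simp
    also have "\<dots> = donaldson_futaki P d L v w f"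
      unfolding g_def using futaki_add[OF f(1) lc] futaki_vanishes[OF l] by simp
    finally show ?thesis .
  qed
  then show ?thesis unfolding uniformly_K_stable_def using c by blast
qed

end

theorem theorem2p6:
  fixes P :: "'a::euclidean_space set"
    and d :: nat
    and L :: "nat \<Rightarrow> 'a \<Rightarrow> real"
    and x\<^sub>0 :: 'a
    and v w :: "'a \<Rightarrow> real"
  assumes "labelled_polytope P d L"
    and "x\<^sub>0 \<in> interior P"
    and "C1_on P v"
    and "\<forall>x\<in>P. v x > 0"
    and "continuous_on P w"
    and "\<forall>f. affine_fun f \<longrightarrow> donaldson_futaki P d L v w f = 0"
    and "\<forall>j\<in>{1..d}. \<forall>x\<in>facet_cone P L x\<^sub>0 j.
           1 / L j x\<^sub>0 * (v x * (real DIM('a) + 1) + differential_on P v x (x - x\<^sub>0))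
           - w x / 2 \<ge> 0"
  shows "uniformly_K_stable P d L v w"
proof -
  interpret weighted_polytope P d L x\<^sub>0 v w using assms(1-5) by unfold_locales
  interpret futaki_polytope P d L x\<^sub>0 v w
  proof unfold_locales
    show "0 \<le> defect j x" if "j \<in> {1..d}" "x \<in> cone j" for j x
      using assms(7) that by (simp add: defect_def radial_density_def mult.commute)
  qed (use assms(6) in blast)
  show ?thesis by (rule uniformly_K_stable)
qed

end
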